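(* Suppose $\mathcal{F}$ is a finite collection of non-unary operations on a nonempty set $A$ and $\mathcal{G}$ is any collection of unary operations on $A$. Then $\mathscr{R}(A,\mathcal{F}\cup\mathcal{G})$ is a Ramsey space if and only if $(A,\mathcal{F}\cup\mathcal{G})$ is a Ramsey algebra.
   Context: $\omega=\{0,1,2,\dotsc\}$ and $\mathbb{N}$ is the set of positive integers. An algebra is a pair $(A,\mathcal{F})$ where $A$ is a nonempty set and $\mathcal{F}$ is a (possibly empty) collection of finitary operations on $A$, none of which is nullary (so non-unary operations have arity at least $2$). For a finite sequence $\vec{x}$ whose length is the arity of $f$, $f(\vec{x})$ denotes $f$ applied to the terms of $\vec{x}$ in order; whenever $f(\vec{x})$ is written, the length of $\vec{x}$ is assumed to equal the arity of $f$. The symbol $\ast$ denotes concatenation of sequences. The Axiom of Choice is assumed. Orderly terms: an operation $f\colon A^m\to A$ is an orderly composition of a collection $\mathcal{C}$ of operations on $A$ if there are $n,k_1,\dotsc,k_n\in\mathbb{N}$ and $g,h_1,\dotsc,h_n\in\mathcal{C}$ such that $g$ is $n$-ary, $h_i$ is $k_i$-ary, $m=\sum_{i=1}^n k_i$, and $f(\vec{x}_1\ast\dotsb\ast\vec{x}_n)=g(h_1(\vec{x}_1),\dotsc,h_n(\vec{x}_n))$ for all finite sequences $\vec{x}_i$ in $A$ of length $k_i$. The collection of orderly terms over $\mathcal{F}$ is the smallest collection of operations on $A$ that includes $\mathcal{F}$, contains the identity function on $A$, and is closed under orderly composition. Reductions: for infinite sequences $\vec{a},\vec{b}\in{}^{\omega}A$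 (sequences indexed by $\omega$), $\vec{b}\leq_{\mathcal{F}}\vec{a}$ means that there are finite sequences $\vec{a}_k$ and orderly terms $f_k$ over $\mathcal{F}$ ($k\in\omega$) such that $\vec{a}_0\ast\vec{a}_1\ast\vec{a}_2\ast\dotsb$ is a subsequence of $\vec{a}$ and $\vec{b}(k)=f_k(\vec{a}_k)$ for all $k\in\omega$. The relation $\leq_{\mathcal{F}}$ is a preorder on ${}^{\omega}A$. $\mathrm{FR}_{\mathcal{F}}(\vec{b})$ is the set of all elements $f(\vec{b}_0)$ with $f$ an orderly term over $\mathcal{F}$ and $\vec{b}_0$ a finite subsequence of $\vec{b}$. $(A,\mathcal{F})$ is a Ramsey algebra if for every $\vec{a}\in{}^{\omega}A$ and $X\subseteq A$ there exists $\vec{b}\leq_{\mathcal{F}}\vec{a}$ such that $\mathrm{FR}_{\mathcal{F}}(\vec{b})$ is either contained in or disjoint from $X$. Ramsey spaces: a preorder with approximations is a pair $\mathfrak{R}=(R,\leq)$ where $R$ is a nonempty set of infinite sequences and $\leq$ is a preorder (reflexive, transitive relation) on $R$. For $n\in\omega$ and $\vec{a}\in R$, let $[n,\vec{a}]_{\mathfrak{R}}=\{\vec{b}\in R\mid \vec{b}\leq\vec{a}\text{ and }\vec{b}\upharpoonright n=\vec{a}\upharpoonright n\}$, where $\vec{a}\upharpoonright n$ is the initial segment of $\vec{a}$ of length $n$. The natural topology on $\mathfrak{R}$ is the topology generated by the sets $[n,\vec{a}]_{\mathfrak{R}}$. A subset $X\subseteq R$ is Ramsey if for every $n\in\omega$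 and $\vec{a}\in R$ there exists $\vec{b}\in[n,\vec{a}]_{\mathfrak{R}}$ such that $[n,\vec{b}]_{\mathfrak{R}}$ is either contained in or disjoint from $X$. A set in a topological space has the property of Baire if its symmetric difference with some open set is meager. $\mathfrak{R}$ is a Ramsey space if every subset of $R$ that has the property of Baire in the natural topology is Ramsey. For an algebra $(A,\mathcal{F})$, $\mathscr{R}(A,\mathcal{F})$ denotes the preorder with approximations $({}^{\omega}A,\leq_{\mathcal{F}})$. *)

theory Defs
  imports "HOL-Analysis.Abstract_Topology" "HOL-Library.FuncSet"
begin

section \<open>Operations and orderly terms\<close>

text \<open>A finitary operation on \<open>A\<close> is a pair of its arity and a function on lists.  The function
  is extensional (it is \<open>undefined\<close> outside the tuples of the right length over \<open>A\<close>), so that equality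
  of such pairs is equality of operations.  Nullary operations are excluded.\<close>

type_synonym 'a operation = "nat \<times> ('a list \<Rightarrow> 'a)"

abbreviation arity :: "'a operation \<Rightarrow> nat" where
  "arity f \<equiv> fst f"

abbreviation app :: "'a operation \<Rightarrow> 'a list \<Rightarrow> 'a" where
  "app f \<equiv> snd f"

definition tuples :: "'a set \<Rightarrow> nat \<Rightarrow> 'a list set" where
  "tuples A n = {xs. set xs \<subseteq> A \<and> length xs = n}"

definition operations :: "'a set \<Rightarrow> 'a operation set" where
  "operations A = (SIGMA n:{1..}. tuples A n \<rightarrow>\<^sub>E A)"

definition identity_op :: "'a set \<Rightarrow> 'a operation" where
  "identity_op A = (1, restrict hd (tuples A 1))"

definition orderly_composition :: "'a set \<Rightarrow> 'a operation set \<Rightarrow> 'a operation \<Rightarrow> bool" where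
  "orderly_composition A C f \<longleftrightarrow>
     f \<in> operations A \<and>
     (\<exists>g\<in>C. \<exists>hs. set hs \<subseteq> C \<and> arity g = length hs \<and> arity f = sum_list (map arity hs) \<and>
        (\<forall>xss. list_all2 (\<lambda>h xs. xs \<in> tuples A (arity h)) hs xss \<longrightarrow>
           app f (concat xss) = app g (map2 app hs xss)))"

definition orderly_terms :: "'a set \<Rightarrow> 'a operation set \<Rightarrow> 'a operation set" where
  "orderly_terms A F = \<Inter>{C. C \<subseteq> operations A \<and> F \<subseteq> C \<and> identity_op A \<in> C \<and>
                            (\<forall>f. orderly_composition A C f \<longrightarrow> f \<in> C)}"


section \<open>Reductions and Ramsey algebras\<close>

abbreviation sequences :: "'a set \<Rightarrow> (nat \<Rightarrow> 'a) set" where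
  "sequences A \<equiv> UNIV \<rightarrow> A"

text \<open>The infinite concatenation of \<open>xss 0\<close>, \<open>xss 1\<close>, \dots.  It is only used for nonempty lists
  (orderly terms have positive arity), so the first \<open>i + 1\<close> lists determine its \<open>i\<close>-th entry.\<close>

definition iconcat :: "(nat \<Rightarrow> 'a list) \<Rightarrow> nat \<Rightarrow> 'a" where
  "iconcat xss i = concat (map xss [0..<Suc i]) ! i"

definition reduces :: "'a set \<Rightarrow> 'a operation set \<Rightarrow> (nat \<Rightarrow> 'a) \<Rightarrow> (nat \<Rightarrow> 'a) \<Rightarrow> bool" where
  "reduces A F b a \<longleftrightarrow>
     (\<exists>as fs. (\<forall>k. fs k \<in> orderly_terms A F \<and> length (as k) = arity (fs k) \<and>
                   b k = app (fs k) (as k)) \<and>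
              (\<exists>\<phi>. strict_mono \<phi> \<and> iconcat as = a \<circ> \<phi>))"

definition FR :: "'a set \<Rightarrow> 'a operation set \<Rightarrow> (nat \<Rightarrow> 'a) \<Rightarrow> 'a set" where
  "FR A F b = {app f (map b ns) | f ns.
                 f \<in> orderly_terms A F \<and> sorted_wrt (<) ns \<and> length ns = arity f}"

definition ramsey_algebra :: "'a set \<Rightarrow> 'a operation set \<Rightarrow> bool" where
  "ramsey_algebra A F \<longleftrightarrow>
     (\<forall>a\<in>sequences A. \<forall>X\<subseteq>A. \<exists>b\<in>sequences A.
        reduces A F b a \<and> (FR A F b \<subseteq> X \<or> FR A F b \<inter> X = {}))"


section \<open>Ramsey spaces\<close>

definition nowhere_dense_in :: "'b topology \<Rightarrow> 'b set \<Rightarrow> bool" where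
  "nowhere_dense_in T S \<longleftrightarrow> S \<subseteq> topspace T \<and> T interior_of (T closure_of S) = {}"

definition meager_in :: "'b topology \<Rightarrow> 'b set \<Rightarrow> bool" where
  "meager_in T S \<longleftrightarrow> (\<exists>N :: nat \<Rightarrow> 'b set. (\<forall>i. nowhere_dense_in T (N i)) \<and> S = (\<Union>i. N i))"

definition property_of_Baire :: "'b topology \<Rightarrow> 'b set \<Rightarrow> bool" where
  "property_of_Baire T S \<longleftrightarrow> S \<subseteq> topspace T \<and> (\<exists>U. openin T U \<and> meager_in T (sym_diff S U))"

definition preorder_with_approximations ::
    "(nat \<Rightarrow> 'a) set \<Rightarrow> ((nat \<Rightarrow> 'a) \<Rightarrow> (nat \<Rightarrow> 'a) \<Rightarrow> bool) \<Rightarrow> bool" where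
  "preorder_with_approximations R le \<longleftrightarrow> R \<noteq> {} \<and> reflp_on R le \<and> transp_on R le"

definition approx_nbhd ::
    "(nat \<Rightarrow> 'a) set \<Rightarrow> ((nat \<Rightarrow> 'a) \<Rightarrow> (nat \<Rightarrow> 'a) \<Rightarrow> bool) \<Rightarrow> nat \<Rightarrow> (nat \<Rightarrow> 'a) \<Rightarrow> (nat \<Rightarrow> 'a) set"
  where "approx_nbhd R le n a = {b \<in> R. le b a \<and> (\<forall>i<n. b i = a i)}"

definition natural_topology ::
    "(nat \<Rightarrow> 'a) set \<Rightarrow> ((nat \<Rightarrow> 'a) \<Rightarrow> (nat \<Rightarrow> 'a) \<Rightarrow> bool) \<Rightarrow> (nat \<Rightarrow> 'a) topology" where
  "natural_topology R le = topology_generated_by {approx_nbhd R le n a | n a. a \<in> R}"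

definition ramsey_set ::
    "(nat \<Rightarrow> 'a) set \<Rightarrow> ((nat \<Rightarrow> 'a) \<Rightarrow> (nat \<Rightarrow> 'a) \<Rightarrow> bool) \<Rightarrow> (nat \<Rightarrow> 'a) set \<Rightarrow> bool" where
  "ramsey_set R le X \<longleftrightarrow>
     (\<forall>n. \<forall>a\<in>R. \<exists>b\<in>approx_nbhd R le n a.
        approx_nbhd R le n b \<subseteq> X \<or> approx_nbhd R le n b \<inter> X = {})"

definition ramsey_space ::
    "(nat \<Rightarrow> 'a) set \<Rightarrow> ((nat \<Rightarrow> 'a) \<Rightarrow> (nat \<Rightarrow> 'a) \<Rightarrow> bool) \<Rightarrow> bool" where
  "ramsey_space R le \<longleftrightarrow>
     preorder_with_approximations R le \<and>
     (\<forall>X\<subseteq>R. property_of_Baire (natural_topology R le) X \<longrightarrow> ramsey_set R le X)"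

end

theory Submission
  imports Defs "HOL-Library.Sublist" "HOL-Library.Omega_Words_Fun"
begin

text \<open>In \<open>[n, a]\<close> the first \<open>n\<close> entries of \<open>a\<close> are followed by an arbitrary reduction of the \<open>n\<close>-th
  tail of \<open>a\<close>, because every entry of a reduction consumes at least one entry of \<open>a\<close>.  A Ramsey
  space therefore gives a Ramsey algebra by way of the clopen sets \<open>{b. b 0 \<in> X}\<close>.

  Conversely, in a Ramsey algebra every sequence has a reduction \<open>b\<close> all of whose \<open>FR\<close>-elements are
  fixed by all operations in \<open>G\<close>: otherwise choosing for each point an operation that moves it gives
  a map without fixed points on some \<open>FR(b)\<close>, and two suitable colourings have no common
  homogeneous set closed under this map.  On such a \<open>b\<close> the orderly terms over \<open>F \<union> G\<close> agree with
  orderly terms over \<open>F\<close>, so each finite part of \<open>b\<close> has only finitely many reductions.  This makes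
  fusion possible, and Ellentuck's argument applies: open sets are Ramsey by combinatorial forcing
  with the Ramsey algebra property as pigeonhole principle, and meager sets are avoided by fusion.\<close>

hide_const (open) Sublist.prefix Sublist.suffix
unbundle no funcset_syntax

section \<open>Reductions between sequences\<close>

text \<open>\<open>V xs\<close> stands for the set of values of orderly terms at the subsequences of \<open>xs\<close>.\<close>

locale term_values =
  fixes A :: "'a set" and V :: "'a list \<Rightarrow> 'a set"
  assumes V_closed: "set xs \<subseteq> A \<Longrightarrow> V xs \<subseteq> A"
    and V_single: "x \<in> A \<Longrightarrow> x \<in> V [x]"
    and V_subseq: "subseq ys xs \<Longrightarrow> V ys \<subseteq> V xs"
    and V_concat: "list_all2 (\<lambda>x ys. x \<in> V ys) xs yss \<Longrightarrow> set (concat yss) \<subseteq> A \<Longrightarrow>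
                     V xs \<subseteq> V (concat yss)"
begin

text \<open>A reduction is encoded by its cutting points: entry \<open>k\<close> is a value on the
  \<open>k\<close>-th block of \<open>a\<close>. Entries of \<open>a\<close> skipped between or
  inside the pieces are absorbed into the blocks by \<open>V_subseq\<close>, and \<open>m 0\<close>
  may be positive. \<open>reduces_iff\<close> identifies this with \<open>reduces\<close> when
  \<open>V\<close> is the set of term values.\<close>

definition le :: "'a word \<Rightarrow> 'a word \<Rightarrow> bool" where
  "le b a \<longleftrightarrow> (\<exists>m. strict_mono m \<and> (\<forall>k. b k \<in> V (a [m k \<rightarrow> m (Suc k)])))"

lemma V_interval_mono:
  assumes "i' \<le> i" "j \<le> j'"
  shows "V (a [i \<rightarrow> j]) \<subseteq> V (a [i' \<rightarrow> j'])"
proof (rule V_subseq)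
  have "subseq [i..<j] [i'..<j']"
    using assms by (intro sorted_subset_imp_subseq) auto
  then show "subseq (a [i \<rightarrow> j]) (a [i' \<rightarrow> j'])"
    unfolding subsequence_def by (rule subseq_map)
qed

lemma sequence_entries: "a \<in> sequences A \<Longrightarrow> a i \<in> A"
  by (auto simp: Pi_iff)

lemma sequence_interval: "a \<in> sequences A \<Longrightarrow> set (a [i \<rightarrow> j]) \<subseteq> A"
  by auto

lemma suffix_sequence [simp]: "a \<in> sequences A \<Longrightarrow> suffix n a \<in> sequences A"
  by (auto simp: Pi_iff)

lemma conc_sequence: "set s \<subseteq> A \<Longrightarrow> a \<in> sequences A \<Longrightarrow> s \<frown> a \<in> sequences A"
  by (auto simp: Pi_iff conc_def in_mono)

lemma le_sequence:
  assumes "le b a" "a \<in> sequences A"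
  shows "b \<in> sequences A"
  using assms V_closed[OF sequence_interval[OF assms(2)]] unfolding le_def Pi_iff by blast

lemma concat_intervals:
  assumes "mono m"
  shows "concat (map (\<lambda>k. (a [m k \<rightarrow> m (Suc k)])) [i..<i + n]) = a [m i \<rightarrow> m (i + n)]"
proof (induction n)
  case (Suc n)
  have "m i \<le> m (i + n)" "m (i + n) \<le> m (Suc (i + n))"
    using assms by (auto intro: monoD)
  then have "[m i..<m (i + n)] @ [m (i + n)..<m (Suc (i + n))] = [m i..<m (Suc (i + n))]"
    using upt_add_eq_append[of "m i" "m (i + n)" "m (Suc (i + n)) - m (i + n)"] by simp
  then have "a [m i \<rightarrow> m (Suc (i + n))] = a [m i \<rightarrow> m (i + n)] @ a [m (i + n) \<rightarrow> m (Suc (i + n))]"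
    unfolding subsequence_def by (metis map_append)
  then show ?case
    using Suc by simp
qed simp

text \<open>The blocks of consecutive entries of \<open>b\<close> join up to one interval of
  \<open>a\<close>, so \<open>V_concat\<close> composes the values.\<close>

lemma V_interval_reduction:
  assumes "strict_mono m" "\<And>k. b k \<in> V (a [m k \<rightarrow> m (Suc k)])" "a \<in> sequences A"
  shows "V (b [i \<rightarrow> j]) \<subseteq> V (a [m i \<rightarrow> m j])"
proof (cases "i \<le> j")
  case True
  then obtain n where j: "j = i + n"
    by (metis le_iff_add)
  let ?yss = "map (\<lambda>k. (a [m k \<rightarrow> m (Suc k)])) [i..<j]"
  have conc: "concat ?yss = a [m i \<rightarrow> m j]"
    unfolding j by (rule concat_intervals) (simp add: strict_mono_mono assms(1))
  have "list_all2 (\<lambda>x ys. x \<in> V ys) (b [i \<rightarrow> j]) ?yss"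
    using assms(2) by (simp add: subsequence_def list_all2_conv_all_nth)
  from V_concat[OF this] show ?thesis
    unfolding conc using sequence_interval[OF assms(3)] by blast
next
  case False
  then have "b [i \<rightarrow> j] = []"
    by simp
  then show ?thesis
    using V_subseq[of "[]"] by simp
qed

text \<open>One sequence of cutting points serves all tails and all intervals at once, so that later
  proofs can compare position \<open>n\<close> of \<open>b\<close> with position \<open>m n\<close>
  of \<open>a\<close> throughout.\<close>

lemma le_decompose:
  assumes "le b a" "a \<in> sequences A"
  obtains m where "strict_mono m" "\<And>n. le (suffix n b) (suffix (m n) a)"
    "\<And>i j. V (b [i \<rightarrow> j]) \<subseteq> V (a [m i \<rightarrow> m j])" "\<And>k. b k \<in> V (a [m k \<rightarrow> m (Suc k)])"
proof -
  obtain m where m: "strict_mono m" "\<And>k. b k \<in> V (a [m k \<rightarrow> m (Suc k)])"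
    using assms(1) unfolding le_def by blast
  have "le (suffix n b) (suffix (m n) a)" for n
    unfolding le_def
  proof (intro exI[of _ "\<lambda>k. m (n + k) - m n"] conjI allI)
    have ge: "m n \<le> m (n + k)" for k
      using m(1) by (simp add: strict_mono_less_eq)
    show "strict_mono (\<lambda>k. m (n + k) - m n)"
      using ge by (intro strict_monoI) (simp add: diff_less_mono m(1) strict_mono_less)
    show "suffix n b k \<in> V (suffix (m n) a [m (n + k) - m n \<rightarrow> m (n + Suc k) - m n])" for k
      using m(2)[of "n + k"] ge[of k] ge[of "Suc k"] by simp
  qed
  with that m V_interval_reduction[OF m assms(2)] show thesis
    by blast
qed

section \<open>Preorder laws, tails and prepended finite parts\<close>

lemma le_refl:
  assumes "a \<in> sequences A" shows "le a a"
  unfolding le_def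
  by (intro exI[of _ "\<lambda>k. k"] conjI strict_monoI)
    (simp_all add: V_single sequence_entries[OF assms])

lemma le_trans:
  assumes "le c b" "le b a" "a \<in> sequences A"
  shows "le c a"
proof -
  obtain m where m: "strict_mono m" "\<And>i j. V (b [i \<rightarrow> j]) \<subseteq> V (a [m i \<rightarrow> m j])"
    using le_decompose[OF assms(2,3)] by metis
  obtain l where l: "strict_mono l" "\<And>k. c k \<in> V (b [l k \<rightarrow> l (Suc k)])"
    using assms(1) unfolding le_def by blast
  show ?thesis
    unfolding le_def
  proof (intro exI[of _ "\<lambda>k. m (l k)"] conjI allI)
    show "strict_mono (\<lambda>k. m (l k))"
      using m(1) l(1) by (simp add: strict_mono_def)
    show "c k \<in> V (a [m (l k) \<rightarrow> m (l (Suc k))])" for k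
      using m(2) l(2) by blast
  qed
qed

lemma le_suffix_self:
  assumes "a \<in> sequences A" shows "le (suffix n a) a"
  unfolding le_def
  by (intro exI[of _ "\<lambda>k. n + k"] conjI strict_monoI)
    (simp_all add: V_single sequence_entries[OF assms])

lemma le_suffix_antimono:
  assumes "a \<in> sequences A" "i \<le> j" shows "le (suffix j a) (suffix i a)"
  using le_suffix_self[of "suffix i a" "j - i"] assms by simp

text \<open>Strictly increasing cutting points satisfy \<open>n \<le> m n\<close>, so the
  \<open>n\<close>-th tail of \<open>b\<close> draws only on entries of \<open>a\<close> from
  position \<open>n\<close> on.\<close>

lemma le_suffix:
  assumes "le b a" "a \<in> sequences A"
  shows "le (suffix n b) (suffix n a)"
proof -
  obtain m where m: "strict_mono m" "\<And>n. le (suffix n b) (suffix (m n) a)"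
    using le_decompose[OF assms] by metis
  show ?thesis
    by (rule le_trans[OF m(2) le_suffix_antimono])
       (use assms strict_mono_imp_increasing[OF m(1)] in auto)
qed

lemma le_conc:
  assumes "le b a" "set s \<subseteq> A"
  shows "le (s \<frown> b) (s \<frown> a)"
proof -
  obtain m where m: "strict_mono m" "\<And>k. b k \<in> V (a [m k \<rightarrow> m (Suc k)])"
    using assms(1) unfolding le_def by blast
  let ?n = "length s"
  let ?m = "\<lambda>k. if k < ?n then k else ?n + m (k - ?n)"
  show ?thesis
    unfolding le_def
  proof (intro exI[of _ ?m] conjI allI)
    show "strict_mono ?m"
      using m(1) by (auto simp: strict_mono_def)
    show "(s \<frown> b) k \<in> V ((s \<frown> a) [?m k \<rightarrow> ?m (Suc k)])" for k
    proof (cases "k < ?n")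
      case True
      have "s ! k \<in> V [s ! k]"
        using True assms(2) by (intro V_single) auto
      moreover have "[s ! k] = (s \<frown> a) [k \<rightarrow> Suc k]"
        using True by simp
      ultimately have "(s \<frown> b) k \<in> V ((s \<frown> a) [k \<rightarrow> Suc k])"
        using True by (metis conc_fst)
      \<comment> \<open>The block of the last entry of \<open>s\<close> runs up to
        \<open>?n + m 0\<close>, so that it absorbs the entries of \<open>a\<close> skipped at the
        start.\<close>
      moreover have "V ((s \<frown> a) [k \<rightarrow> Suc k]) \<subseteq> V ((s \<frown> a) [?m k \<rightarrow> ?m (Suc k)])"
        using True by (intro V_interval_mono) auto
      ultimately show ?thesis
        by blast
    next
      case False
      have "(s \<frown> a) [?n + i \<rightarrow> ?n + j] = a [i \<rightarrow> j]" for i j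
        by (metis subsequence_shift suffix_conc_length)
      moreover have "?m k = ?n + m (k - ?n)" "?m (Suc k) = ?n + m (Suc (k - ?n))"
        using False by (simp_all add: Suc_diff_le)
      ultimately show ?thesis
        using False m(2)[of "k - ?n"] by (simp only: conc_snd not_False_eq_True)
    qed
  qed
qed

text \<open>The diagonal sequence of a fusion: cutting points in \<open>d 0\<close> for all the \<open>d k\<close> are found by
  composing the cutting points of consecutive reductions.\<close>

lemma le_diagonal:
  assumes step: "\<And>k. le (d (Suc k)) (suffix 1 (d k))" and d0: "d 0 \<in> sequences A"
  shows "le (\<lambda>k. d k 0) (d 0)"
proof -
  have d: "d k \<in> sequences A" for k
    by (induction k) (use d0 step le_sequence suffix_sequence in blast)+
  have "\<forall>k. \<exists>m. strict_mono m \<and> (\<forall>i j. V (d (Suc k) [i \<rightarrow> j]) \<subseteq> V (suffix 1 (d k) [m i \<rightarrow> m j]))"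
    using le_decompose[OF step suffix_sequence[OF d]] by metis
  then obtain \<mu> where \<mu>: "\<And>k. strict_mono (\<mu> k)"
      "\<And>k i j. V (d (Suc k) [i \<rightarrow> j]) \<subseteq> V (suffix 1 (d k) [\<mu> k i \<rightarrow> \<mu> k j])"
    by metis
  \<comment> \<open>\<open>\<nu> k\<close> translates positions in \<open>d k\<close> into positions
    in \<open>d 0\<close>. The \<open>Suc\<close> undoes the shift in
    \<open>suffix 1 (d k)\<close>.\<close>
  define \<nu> where "\<nu> = rec_nat (\<lambda>j. j) (\<lambda>k \<nu> j. \<nu> (Suc (\<mu> k j)))"
  have \<nu>_simps: "\<nu> 0 = (\<lambda>j. j)" "\<nu> (Suc k) j = \<nu> k (Suc (\<mu> k j))" for k j
    by (simp_all add: \<nu>_def)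
  have mono: "strict_mono (\<nu> k)" for k
    by (induction k) (use \<mu>(1) in \<open>auto simp: \<nu>_simps strict_mono_def\<close>)
  have V: "V (d k [i \<rightarrow> j]) \<subseteq> V (d 0 [\<nu> k i \<rightarrow> \<nu> k j])" for k i j
  proof (induction k arbitrary: i j)
    case (Suc k)
    have "V (d (Suc k) [i \<rightarrow> j]) \<subseteq> V (d k [Suc (\<mu> k i) \<rightarrow> Suc (\<mu> k j)])"
      using \<mu>(2)[of k i j] by simp
    with Suc show ?case
      by (fastforce simp: \<nu>_simps)
  qed (simp add: \<nu>_simps)
  show ?thesis
    unfolding le_def
  proof (intro exI[of _ "\<lambda>k. \<nu> k 0"] conjI allI)
    show "strict_mono (\<lambda>k. \<nu> k 0)"
      by (simp add: strict_mono_Suc_iff \<nu>_simps strict_monoD[OF mono])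
    fix k
    have "d k 0 \<in> V (d k [0 \<rightarrow> Suc 0])"
      by (simp add: V_single sequence_entries[OF d])
    then have "d k 0 \<in> V (d 0 [\<nu> k 0 \<rightarrow> \<nu> k (Suc 0)])"
      using V by blast
    moreover have "\<nu> k (Suc 0) \<le> \<nu> (Suc k) 0"
      by (simp add: \<nu>_simps strict_mono_less_eq[OF mono])
    ultimately show "d k 0 \<in> V (d 0 [\<nu> k 0 \<rightarrow> \<nu> (Suc k) 0])"
      using V_interval_mono[of "\<nu> k 0" "\<nu> k 0"] by blast
  qed
qed


section \<open>The natural topology\<close>

text \<open>A basic neighbourhood with the finite part \<open>s\<close> separated from the reservoir
  \<open>a\<close>, so that the reservoir can be thinned while \<open>s\<close> stays fixed.\<close>

definition cone :: "'a list \<Rightarrow> 'a word \<Rightarrow> 'a word set" where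
  "cone s a = {s \<frown> d |d. le d a}"

abbreviation T :: "'a word topology" where
  "T \<equiv> natural_topology (sequences A) le"

lemma cone_mono: "le b a \<Longrightarrow> a \<in> sequences A \<Longrightarrow> cone s b \<subseteq> cone s a"
  unfolding cone_def using le_trans by blast

lemma approx_nbhd_eq_cone:
  assumes "a \<in> sequences A"
  shows "approx_nbhd (sequences A) le n a = cone (prefix n a) (suffix n a)"
proof (intro equalityI subsetI)
  fix b assume b: "b \<in> approx_nbhd (sequences A) le n a"
  then have "prefix n b = prefix n a"
    by (auto simp: approx_nbhd_def subsequence_def)
  then have "b = prefix n a \<frown> suffix n b"
    using prefix_suffix[of b n] by simp
  moreover have "le (suffix n b) (suffix n a)"
    using b le_suffix assms by (auto simp: approx_nbhd_def)
  ultimately show "b \<in> cone (prefix n a) (suffix n a)"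
    by (auto simp: cone_def)
next
  fix b assume "b \<in> cone (prefix n a) (suffix n a)"
  then obtain d where d: "b = prefix n a \<frown> d" "le d (suffix n a)"
    by (auto simp: cone_def)
  have "le b (prefix n a \<frown> suffix n a)"
    unfolding d(1) using d(2) sequence_interval[OF assms] by (rule le_conc)
  then have "le b a"
    by (simp flip: prefix_suffix)
  then show "b \<in> approx_nbhd (sequences A) le n a"
    using le_sequence[OF _ assms] by (auto simp: approx_nbhd_def d(1))
qed

lemma cone_eq_approx_nbhd:
  assumes "set s \<subseteq> A" "a \<in> sequences A"
  shows "cone s a = approx_nbhd (sequences A) le (length s) (s \<frown> a)"
  using approx_nbhd_eq_cone[OF conc_sequence[OF assms], of "length s"] by simp

lemma approx_nbhd_self: "a \<in> sequences A \<Longrightarrow> a \<in> approx_nbhd (sequences A) le n a"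
  by (simp add: approx_nbhd_def le_refl)

lemma approx_nbhd_subset:
  assumes "b \<in> approx_nbhd (sequences A) le n a" "a \<in> sequences A" "n \<le> k"
  shows "approx_nbhd (sequences A) le k b \<subseteq> approx_nbhd (sequences A) le n a"
  using assms le_trans by (fastforce simp: approx_nbhd_def)

text \<open>The generating sets already form a base, since \<open>[max n m, a]\<close> lies in both
  \<open>[n, a]\<close> and \<open>[m, a]\<close>; openness is therefore tested at each point by its
  own neighbourhoods.\<close>

lemma openin_T:
  "openin T U \<longleftrightarrow> U \<subseteq> sequences A \<and> (\<forall>a\<in>U. \<exists>n. approx_nbhd (sequences A) le n a \<subseteq> U)"
  (is "_ \<longleftrightarrow> ?open U")
proof
  assume "openin T U"
  then have "generate_topology_on {approx_nbhd (sequences A) le n a | n a. a \<in> sequences A} U"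
    by (simp add: natural_topology_def openin_topology_generated_by_iff)
  then show "?open U"
  proof induction
    case (Int U W)
    have "\<exists>k. approx_nbhd (sequences A) le k a \<subseteq> U \<inter> W" if a: "a \<in> U \<inter> W" for a
    proof -
      obtain n m where "approx_nbhd (sequences A) le n a \<subseteq> U" "approx_nbhd (sequences A) le m a \<subseteq> W"
        using Int.IH a by blast
      moreover have "a \<in> sequences A"
        using Int.IH a by blast
      ultimately show ?thesis
        using approx_nbhd_subset[OF approx_nbhd_self, of a _ "max n m"]
        by (intro exI[of _ "max n m"]) (meson Int_greatest dual_order.trans max.cobounded1 max.cobounded2)
    qed
    with Int.IH show ?case
      by blast
  next
    case (UN K)
    then show ?case
      by (meson Sup_least Union_iff Union_upper dual_order.trans)
  next
    case (Basis U)
    then obtain n a where U: "U = approx_nbhd (sequences A) le n a" "a \<in> sequences A"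
      by blast
    then show ?case
      using approx_nbhd_subset[OF _ U(2) order_refl] approx_nbhd_self
      by (metis (no_types, lifting) approx_nbhd_def mem_Collect_eq subsetI)
  qed auto
next
  assume U: "?open U"
  let ?K = "{approx_nbhd (sequences A) le n a | n a. a \<in> U \<and> approx_nbhd (sequences A) le n a \<subseteq> U}"
  have "U = \<Union>?K"
    using U approx_nbhd_self by (intro equalityI subsetI) blast+
  moreover have "openin T (\<Union>?K)"
    unfolding natural_topology_def using U
    by (intro openin_Union) (blast intro: topology_generated_by_Basis)
  ultimately show "openin T U"
    by simp
qed

lemma topspace_T: "topspace T = sequences A"
proof -
  have "openin T (sequences A)"
    unfolding openin_T approx_nbhd_def by blast
  moreover have "topspace T \<subseteq> sequences A"
    using openin_topspace[of T] openin_T by blast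
  ultimately show ?thesis
    using openin_subset by blast
qed

lemma openin_cone:
  assumes "set s \<subseteq> A" "a \<in> sequences A"
  shows "openin T (cone s a)"
  unfolding cone_eq_approx_nbhd[OF assms] natural_topology_def
  by (rule topology_generated_by_Basis) (use conc_sequence[OF assms] in blast)

lemma open_contains_cone:
  assumes "openin T U" "b \<in> U"
  obtains n where "\<And>k. n \<le> k \<Longrightarrow> cone (prefix k b) (suffix k b) \<subseteq> U"
proof -
  have b: "b \<in> sequences A" and "\<exists>n. approx_nbhd (sequences A) le n b \<subseteq> U"
    using assms openin_T by blast+
  then obtain n where n: "approx_nbhd (sequences A) le n b \<subseteq> U"
    by blast
  show thesis
  proof (rule that[of n])
    fix k assume "n \<le> k"
    then show "cone (prefix k b) (suffix k b) \<subseteq> U"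
      using n approx_nbhd_subset[OF approx_nbhd_self[OF b] b] approx_nbhd_eq_cone[OF b] by fastforce
  qed
qed

text \<open>Every sequence splits as \<open>s \<frown> a\<close> at any position, so finite part and
  reservoir may be quantified independently.\<close>

lemma ramsey_set_iff_cone:
  "ramsey_set (sequences A) le X \<longleftrightarrow>
     (\<forall>s a. set s \<subseteq> A \<longrightarrow> a \<in> sequences A \<longrightarrow> (\<exists>b. le b a \<and> (cone s b \<subseteq> X \<or> cone s b \<inter> X = {})))"
  (is "_ \<longleftrightarrow> ?C")
proof
  assume X: "ramsey_set (sequences A) le X"
  show ?C
  proof (intro allI impI)
    fix s a assume sa: "set s \<subseteq> A" "a \<in> sequences A"
    then obtain b where b: "b \<in> cone s a"
      "approx_nbhd (sequences A) le (length s) b \<subseteq> X \<or> approx_nbhd (sequences A) le (length s) b \<inter> X = {}"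
      using X conc_sequence[OF sa] unfolding ramsey_set_def cone_eq_approx_nbhd[OF sa] by blast
    then obtain d where d: "b = s \<frown> d" "le d a"
      by (auto simp: cone_def)
    then have "approx_nbhd (sequences A) le (length s) b = cone s d"
      using cone_eq_approx_nbhd[OF sa(1) le_sequence[OF d(2) sa(2)]] by simp
    then show "\<exists>b. le b a \<and> (cone s b \<subseteq> X \<or> cone s b \<inter> X = {})"
      using b(2) d(2) by auto
  qed
next
  assume C: ?C
  show "ramsey_set (sequences A) le X"
    unfolding ramsey_set_def
  proof (intro allI ballI)
    fix n a assume a: "a \<in> sequences A"
    let ?s = "prefix n a"
    have s: "set ?s \<subseteq> A"
      using sequence_interval[OF a] .
    obtain b where b: "le b (suffix n a)" "cone ?s b \<subseteq> X \<or> cone ?s b \<inter> X = {}"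
      using C s suffix_sequence[OF a] by blast
    have "?s \<frown> b \<in> approx_nbhd (sequences A) le n a"
      unfolding approx_nbhd_eq_cone[OF a] cone_def using b(1) by blast
    moreover have "approx_nbhd (sequences A) le n (?s \<frown> b) = cone ?s b"
      using cone_eq_approx_nbhd[OF s le_sequence[OF b(1) suffix_sequence[OF a]]] by simp
    ultimately show "\<exists>b\<in>approx_nbhd (sequences A) le n a.
        approx_nbhd (sequences A) le n b \<subseteq> X \<or> approx_nbhd (sequences A) le n b \<inter> X = {}"
      using b(2) by metis
  qed
qed

end


section \<open>Fusion and the Baire property\<close>

text \<open>The two consequences of the Ramsey algebra property on which Ellentuck's argument rests:
  \<open>pigeonhole\<close> decides one-entry extensions, \<open>finite_below\<close> makes fusion
  possible.\<close>

locale ramsey_term_values = term_values +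
  assumes pigeonhole: "a \<in> sequences A \<Longrightarrow>
      \<exists>b. le b a \<and> ((\<forall>n. V (prefix n b) \<subseteq> Y) \<or> (\<forall>n. V (prefix n b) \<inter> Y = {}))"
    and finite_below: "a \<in> sequences A \<Longrightarrow> \<exists>b. le b a \<and> (\<forall>n. finite (V (prefix n b)))"
begin

text \<open>At each stage only finitely many finite parts \<open>u\<close> can occur, because value
  sets of prefixes are finite below \<open>a\<close>. A dense hereditary property is therefore
  secured for all of them before the next entry is fixed.\<close>

lemma fusion:
  assumes dense: "\<And>u a. set u \<subseteq> A \<Longrightarrow> a \<in> sequences A \<Longrightarrow> \<exists>d. le d a \<and> P u d"
    and hereditary: "\<And>u c d. P u d \<Longrightarrow> le c d \<Longrightarrow> d \<in> sequences A \<Longrightarrow> P u c"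
    and a: "a \<in> sequences A"
  obtains b where "le b a"
    "\<And>i u. set u \<subseteq> V (prefix i b) \<Longrightarrow> length u \<le> i \<Longrightarrow> P u (suffix i b)"
proof -
  have dense_finite: "\<exists>d. le d c \<and> (\<forall>u\<in>U. P u d)"
    if "finite U" "\<forall>u\<in>U. set u \<subseteq> A" "c \<in> sequences A" for U c
    using that
  proof (induction U)
    case empty
    then show ?case
      using le_refl by auto
  next
    case (insert u U)
    then obtain d where d: "le d c" "\<forall>u\<in>U. P u d"
      by auto
    have dA: "d \<in> sequences A"
      using le_sequence d(1) insert.prems by blast
    then obtain e where e: "le e d" "P u e"
      using dense insert.prems by (meson insertI1)
    have "le e c"
      using le_trans[OF e(1) d(1)] insert.prems by blast
    moreover have "\<forall>u\<in>U. P u e"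
      using d(2) hereditary[OF _ e(1) dA] by blast
    ultimately show ?case
      using e(2) by blast
  qed
  obtain a0 where a0: "le a0 a" "\<And>n. finite (V (prefix n a0))"
    using finite_below[OF a] by blast
  have a0A: "a0 \<in> sequences A"
    using le_sequence[OF a0(1) a] .
  \<comment> \<open>The finite parts to be treated once \<open>p\<close> is fixed. Keeping
    \<open>p \<frown> d\<close> below \<open>a0\<close> makes \<open>V p\<close>, and hence
    \<open>L p\<close>, finite.\<close>
  define L where "L p = {u. set u \<subseteq> V p \<and> length u \<le> length p}" for p
  have shrink: "\<exists>d. le d c \<and> d \<in> sequences A \<and> le (p \<frown> d) a0 \<and> (\<forall>u\<in>L p. P u d)"
    if p: "set p \<subseteq> A" and c: "c \<in> sequences A" and le: "le (p \<frown> c) a0" for p c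
  proof -
    obtain m where m: "\<And>i j. V ((p \<frown> c) [i \<rightarrow> j]) \<subseteq> V (a0 [m i \<rightarrow> m j])"
      using le_decompose[OF le a0A] by metis
    have "V p \<subseteq> V (a0 [m 0 \<rightarrow> m (length p)])"
      using m[of 0 "length p"] by simp
    also have "\<dots> \<subseteq> V (prefix (m (length p)) a0)"
      by (rule V_interval_mono) auto
    finally have "finite (V p)"
      using a0(2) finite_subset by blast
    then have "finite (L p)"
      unfolding L_def by (rule finite_lists_length_le)
    moreover have "\<forall>u\<in>L p. set u \<subseteq> A"
      using V_closed[OF p] by (auto simp: L_def)
    ultimately obtain d where d: "le d c" "\<forall>u\<in>L p. P u d"
      using dense_finite c by blast
    then show ?thesis
      using le_trans[OF le_conc[OF d(1) p] le a0A] le_sequence[OF d(1) c] by blast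
  qed
  \<comment> \<open>A state consists of the entries \<open>p\<close> fixed so far and the reservoir
    \<open>d\<close>; a step moves the head of \<open>d\<close> into \<open>p\<close> and thins the
    rest.\<close>
  let ?I = "\<lambda>k (p, d). length p = k \<and> set p \<subseteq> A \<and> d \<in> sequences A \<and> le (p \<frown> d) a0 \<and> (\<forall>u\<in>L p. P u d)"
  let ?R = "\<lambda>(p, d) (p', d'). p' = p @ [d 0] \<and> le d' (suffix 1 d)"
  have "\<exists>f. \<forall>k. ?I k (f k) \<and> ?R (f k) (f (Suc k))"
  proof (rule dependent_nat_choice)
    show "\<exists>pd. ?I 0 pd"
      using shrink[of "[]" a0] a0A le_refl[OF a0A] by auto
  next
    fix pd k assume I: "?I k pd"
    obtain p d where pd: "pd = (p, d)"
      by (cases pd)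
    have p: "length p = k" "set p \<subseteq> A" and d: "d \<in> sequences A" and pd_le: "le (p \<frown> d) a0"
      using I unfolding pd prod.case by blast+
    have p': "set (p @ [d 0]) \<subseteq> A"
      using p(2) sequence_entries[OF d] by simp
    have "p \<frown> d = (p @ [d 0]) \<frown> suffix 1 d"
      using prefix_suffix[of d 1] by (metis One_nat_def conc_conc subsequence_singleton)
    then obtain d' where d': "le d' (suffix 1 d)" "d' \<in> sequences A"
      "le ((p @ [d 0]) \<frown> d') a0" "\<forall>u\<in>L (p @ [d 0]). P u d'"
      using shrink[OF p' suffix_sequence[OF d, of 1]] pd_le by metis
    moreover have "length (p @ [d 0]) = Suc k"
      using p(1) by simp
    ultimately have "?I (Suc k) (p @ [d 0], d') \<and> ?R pd (p @ [d 0], d')"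
      unfolding pd prod.case using p' d' by (intro conjI refl)
    then show "\<exists>pd'. ?I (Suc k) pd' \<and> ?R pd pd'" ..
  qed
  then obtain f where f: "\<forall>k. ?I k (f k) \<and> ?R (f k) (f (Suc k))" ..
  define p d where "p k = fst (f k)" and "d k = snd (f k)" for k
  have I: "length (p k) = k" "d k \<in> sequences A" "le (p k \<frown> d k) a0" "\<forall>u\<in>L (p k). P u (d k)"
    and R: "p (Suc k) = p k @ [d k 0]" "le (d (Suc k)) (suffix 1 (d k))" for k
  proof -
    have "?I k (p k, d k) \<and> ?R (p k, d k) (p (Suc k), d (Suc k))"
      using f[rule_format, of k] unfolding p_def d_def prod.collapse .
    then show "length (p k) = k" "d k \<in> sequences A" "le (p k \<frown> d k) a0" "\<forall>u\<in>L (p k). P u (d k)"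
      "p (Suc k) = p k @ [d k 0]" "le (d (Suc k)) (suffix 1 (d k))"
      by simp_all
  qed
  define b where "b k = d k 0" for k
  have prefix_b: "prefix k b = p k" for k
  proof (induction k)
    case 0
    then show ?case
      using I(1)[of 0] by simp
  next
    case (Suc k)
    then show ?case
      using R(1)[of k] by (simp add: b_def)
  qed
  \<comment> \<open>From position \<open>i\<close> on, \<open>b\<close> is the diagonal of the
    reservoirs starting with \<open>d i\<close>, so heredity carries \<open>P u (d i)\<close> over
    to this tail.\<close>
  have diag: "le (suffix i b) (d i)" for i
  proof -
    have "suffix i b = (\<lambda>k. d (i + k) 0)"
      by (simp add: fun_eq_iff b_def)
    then show ?thesis
      using le_diagonal[of "\<lambda>k. d (i + k)"] R(2) I(2) by simp
  qed
  show thesis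
  proof (rule that)
    have "le b (d 0)"
      using diag[of 0] by simp
    moreover have "le (d 0) a0"
      using I(1,3)[of 0] by simp
    ultimately show "le b a"
      using le_trans a0(1) a a0A by blast
    show "P u (suffix i b)" if "set u \<subseteq> V (prefix i b)" "length u \<le> i" for i u
    proof -
      have "u \<in> L (p i)"
        using that I(1)[of i] by (simp add: L_def prefix_b)
      then show ?thesis
        using I(4) hereditary[OF _ diag I(2)] by blast
    qed
  qed
qed

text \<open>Combinatorial forcing: \<open>u\<close> plays the role of the finite part and \<open>d\<close> of the reservoir.\<close>

definition rejects :: "'a word set \<Rightarrow> 'a list \<Rightarrow> 'a word \<Rightarrow> bool" where
  "rejects X u d \<longleftrightarrow> (\<forall>c. le c d \<longrightarrow> \<not> cone u c \<subseteq> X)"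

text \<open>The second alternative lets rejection propagate: a value \<open>x\<close> read from the
  first \<open>j\<close> entries may be appended, with the reservoir cut at \<open>j\<close>. The
  bound \<open>j > 0\<close> matches \<open>length u \<le> i\<close> in \<open>fusion\<close> for
  \<open>[x]\<close>.\<close>

definition strongly_decides :: "'a word set \<Rightarrow> 'a list \<Rightarrow> 'a word \<Rightarrow> bool" where
  "strongly_decides X u d \<longleftrightarrow> cone u d \<subseteq> X \<or>
     rejects X u d \<and> (\<forall>j>0. \<forall>x\<in>V (prefix j d). rejects X (u @ [x]) (suffix j d))"

lemma rejects_le: "rejects X u d \<Longrightarrow> le c d \<Longrightarrow> d \<in> sequences A \<Longrightarrow> rejects X u c"
  unfolding rejects_def using le_trans by blast

lemma V_prefix_reduction:
  assumes "\<And>i j. V (b [i \<rightarrow> j]) \<subseteq> V (a [m i \<rightarrow> m j])"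
  shows "V (prefix j b) \<subseteq> V (prefix (m j) a)"
  using assms[of 0 j] V_interval_mono[of 0 "m 0" "m j" "m j" a] by auto

lemma strongly_decides_le:
  assumes "strongly_decides X u d" "le c d" "d \<in> sequences A"
  shows "strongly_decides X u c"
proof (cases "cone u d \<subseteq> X")
  case True
  then show ?thesis
    using cone_mono[OF assms(2,3)] by (auto simp: strongly_decides_def)
next
  case False
  obtain m where m: "strict_mono m" "\<And>n. le (suffix n c) (suffix (m n) d)"
      "\<And>i j. V (c [i \<rightarrow> j]) \<subseteq> V (d [m i \<rightarrow> m j])"
    using le_decompose[OF assms(2,3)] by metis
  have "rejects X (u @ [x]) (suffix j c)" if "0 < j" "x \<in> V (prefix j c)" for j x
  proof -
    have "x \<in> V (prefix (m j) d)"
      using V_prefix_reduction[OF m(3)] that(2) by blast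
    moreover have "0 < m j"
      using that(1) strict_mono_imp_increasing[OF m(1), of j] by linarith
    ultimately have "rejects X (u @ [x]) (suffix (m j) d)"
      using False assms(1) by (auto simp: strongly_decides_def)
    then show ?thesis
      using rejects_le[OF _ m(2)] assms(3) by simp
  qed
  moreover have "rejects X u c"
    using False assms rejects_le unfolding strongly_decides_def by blast
  ultimately show ?thesis
    by (auto simp: strongly_decides_def)
qed

text \<open>If \<open>u\<close> is rejected, fusion first decides every extension
  \<open>u @ [x]\<close> on a tail, and \<open>pigeonhole\<close> then makes acceptance uniform over
  all values \<open>x\<close>. Uniform acceptance would put a whole cone of \<open>u\<close> into
  \<open>X\<close>, against rejection, so all extensions are rejected.\<close>

lemma strongly_decides_dense:
  assumes u: "set u \<subseteq> A" and a: "a \<in> sequences A"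
  shows "\<exists>d. le d a \<and> strongly_decides X u d"
proof (cases "rejects X u a")
  case False
  then show ?thesis
    unfolding rejects_def strongly_decides_def by blast
next
  case True
  let ?P = "\<lambda>t d. cone (u @ t) d \<subseteq> X \<or> rejects X (u @ t) d"
  obtain b where b: "le b a"
    "\<And>i t. set t \<subseteq> V (prefix i b) \<Longrightarrow> length t \<le> i \<Longrightarrow> ?P t (suffix i b)"
  proof (rule fusion[of ?P])
    show "\<exists>d. le d a \<and> ?P t d" if "a \<in> sequences A" for t a
      using le_refl[OF that] unfolding rejects_def by blast
    show "?P t c" if "?P t d" "le c d" "d \<in> sequences A" for t c d
      using that rejects_le cone_mono by blast
  qed (use a in auto)
  have bA: "b \<in> sequences A"
    using le_sequence[OF b(1) a] .
  have decided: "cone (u @ [x]) (suffix j b) \<subseteq> X \<or> rejects X (u @ [x]) (suffix j b)"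
    if "x \<in> V (prefix j b)" "0 < j" for x j
    using b(2)[of "[x]" j] that by simp
  define Y where "Y = {x. \<exists>j>0. x \<in> V (prefix j b) \<and> cone (u @ [x]) (suffix j b) \<subseteq> X}"
  obtain c where c: "le c b" "(\<forall>n. V (prefix n c) \<subseteq> Y) \<or> (\<forall>n. V (prefix n c) \<inter> Y = {})"
    using pigeonhole[OF bA] by blast
  have cA: "c \<in> sequences A" and ca: "le c a"
    using le_sequence[OF c(1) bA] le_trans[OF c(1) b(1) a] by auto
  obtain m where m: "strict_mono m" "\<And>n. le (suffix n c) (suffix (m n) b)"
      "\<And>i j. V (c [i \<rightarrow> j]) \<subseteq> V (b [m i \<rightarrow> m j])"
    using le_decompose[OF c(1) bA] by metis
  have m_pos: "0 < m j" if "0 < j" for j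
    using that strict_mono_imp_increasing[OF m(1), of j] by linarith
  have "\<not> (\<forall>n. V (prefix n c) \<subseteq> Y)"
  proof
    assume Y: "\<forall>n. V (prefix n c) \<subseteq> Y"
    \<comment> \<open>A member of the cone begins with \<open>u @ [d 0]\<close>, where
      \<open>d 0\<close> is a value on \<open>c\<close> and so lies in \<open>Y\<close>.\<close>
    have "cone u c \<subseteq> X"
    proof
      fix e assume "e \<in> cone u c"
      then obtain d where d: "e = u \<frown> d" "le d c"
        by (auto simp: cone_def)
      obtain l where l: "strict_mono l" "\<And>n. le (suffix n d) (suffix (l n) c)"
          "\<And>k. d k \<in> V (c [l k \<rightarrow> l (Suc k)])"
        using le_decompose[OF d(2) cA] by metis
      let ?j = "m (l 1)"
      have x: "d 0 \<in> V (prefix (l 1) c)"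
        using l(3)[of 0] V_interval_mono[of 0 "l 0" "l 1" "l 1" c] by auto
      then obtain i where i: "d 0 \<in> V (prefix i b)" "cone (u @ [d 0]) (suffix i b) \<subseteq> X"
        using Y unfolding Y_def by blast
      have "0 < l 1"
        using strict_mono_imp_increasing[OF l(1), of 1] by linarith
      then have "cone (u @ [d 0]) (suffix ?j b) \<subseteq> X \<or> rejects X (u @ [d 0]) (suffix ?j b)"
        using decided x V_prefix_reduction[OF m(3)] m_pos by blast
      \<comment> \<open>The extension is accepted at a position \<open>i\<close> unrelated to
        \<open>?j\<close>; the later of the two tails lies below both and refutes rejection at
        \<open>?j\<close>.\<close>
      moreover have "\<not> rejects X (u @ [d 0]) (suffix ?j b)"
      proof -
        have "cone (u @ [d 0]) (suffix (max i ?j) b) \<subseteq> cone (u @ [d 0]) (suffix i b)"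
          using bA by (intro cone_mono le_suffix_antimono) auto
        moreover have "le (suffix (max i ?j) b) (suffix ?j b)"
          using bA by (intro le_suffix_antimono) auto
        ultimately show ?thesis
          unfolding rejects_def using i(2) by blast
      qed
      moreover have "le (suffix 1 d) (suffix ?j b)"
        using le_trans[OF l(2) m(2)] bA by simp
      moreover have "u \<frown> d = (u @ [d 0]) \<frown> suffix 1 d"
        using prefix_suffix[of d 1] by (metis One_nat_def conc_conc subsequence_singleton)
      ultimately show "e \<in> X"
        unfolding d(1) cone_def by blast
    qed
    then show False
      using True ca by (auto simp: rejects_def)
  qed
  with c(2) have disj: "V (prefix n c) \<inter> Y = {}" for n
    by blast
  have "rejects X (u @ [x]) (suffix j c)" if j: "0 < j" and x: "x \<in> V (prefix j c)" for j x
  proof -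
    have xb: "x \<in> V (prefix (m j) b)"
      using x V_prefix_reduction[OF m(3)] by blast
    then have "\<not> cone (u @ [x]) (suffix (m j) b) \<subseteq> X"
      using disj[of j] x m_pos[OF j] by (auto simp: Y_def)
    then have "rejects X (u @ [x]) (suffix (m j) b)"
      using decided[OF xb m_pos[OF j]] by blast
    then show ?thesis
      using rejects_le[OF _ m(2)] bA by simp
  qed
  then have "strongly_decides X u c"
    using rejects_le[OF True ca a] by (simp add: strongly_decides_def)
  then show ?thesis
    using ca by blast
qed

text \<open>Unless the cone of \<open>s\<close> is contained in \<open>X\<close>, strong decisions
  carry rejection along all initial segments of any \<open>d\<close> below \<open>b\<close>. If
  \<open>s \<frown> d\<close> were in the open set, some finite segment would already have a cone
  inside \<open>X\<close>, contrary to its rejection.\<close>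

lemma open_set_cone:
  assumes X: "openin T X" and s: "set s \<subseteq> A" and a: "a \<in> sequences A"
  shows "\<exists>b. le b a \<and> (cone s b \<subseteq> X \<or> cone s b \<inter> X = {})"
proof -
  let ?P = "\<lambda>t d. set t \<subseteq> A \<longrightarrow> strongly_decides X (s @ t) d"
  obtain b where b: "le b a"
    "\<And>i t. set t \<subseteq> V (prefix i b) \<Longrightarrow> length t \<le> i \<Longrightarrow> ?P t (suffix i b)"
  proof (rule fusion[of ?P])
    show "\<exists>d. le d a \<and> ?P t d" if "set t \<subseteq> A" "a \<in> sequences A" for t a
      using strongly_decides_dense[OF _ that(2), of "s @ t" X] that s by auto
    show "?P t c" if "?P t d" "le c d" "d \<in> sequences A" for t c d
      using that strongly_decides_le by blast
  qed (use a in auto)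
  have bA: "b \<in> sequences A"
    using le_sequence[OF b(1) a] .
  have "cone s b \<inter> X = {}" if notsub: "\<not> cone s b \<subseteq> X"
  proof (rule ccontr)
    assume "cone s b \<inter> X \<noteq> {}"
    then obtain d where d: "le d b" "s \<frown> d \<in> X"
      by (auto simp: cone_def)
    obtain m where m: "strict_mono m" "\<And>n. le (suffix n d) (suffix (m n) b)"
        "\<And>i j. V (d [i \<rightarrow> j]) \<subseteq> V (b [m i \<rightarrow> m j])" "\<And>k. d k \<in> V (b [m k \<rightarrow> m (Suc k)])"
      using le_decompose[OF d(1) bA] by metis
    have decides: "strongly_decides X (s @ prefix n d) (suffix (m n) b)" for n
    proof -
      have "d i \<in> V (prefix (m n) b)" if "i < n" for i
      proof -
        have "m (Suc i) \<le> m n"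
          using that m(1) by (simp add: strict_mono_less_eq)
        then show ?thesis
          using m(4)[of i] V_interval_mono[of 0 "m i" "m (Suc i)" "m n" b] by auto
      qed
      then have "set (prefix n d) \<subseteq> V (prefix (m n) b)"
        by auto
      moreover have "V (prefix (m n) b) \<subseteq> A"
        using V_closed sequence_interval[OF bA] by blast
      ultimately show ?thesis
        using b(2)[of "prefix n d" "m n"] strict_mono_imp_increasing[OF m(1), of n] by auto
    qed
    have rejects: "rejects X (s @ prefix n d) (suffix (m n) b)" for n
    proof (induction n)
      case 0
      have "strongly_decides X s b"
        using b(2)[of "[]" 0] by simp
      then have "rejects X s b"
        using notsub by (auto simp: strongly_decides_def)
      then show ?case
        using rejects_le[OF _ le_suffix_self[OF bA] bA] by (metis append_Nil2 subseq_to_zero)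
    next
      case (Suc n)
      have "\<not> cone (s @ prefix n d) (suffix (m n) b) \<subseteq> X"
        using Suc le_refl[OF suffix_sequence[OF bA]] unfolding rejects_def by blast
      then have *: "\<forall>j>0. \<forall>x\<in>V (prefix j (suffix (m n) b)).
          rejects X ((s @ prefix n d) @ [x]) (suffix j (suffix (m n) b))"
        using decides[of n] unfolding strongly_decides_def by blast
      have lt: "m n < m (Suc n)"
        using m(1) by (simp add: strict_monoD)
      then have "d n \<in> V (prefix (m (Suc n) - m n) (suffix (m n) b))"
        using m(4)[of n] by simp
      with * lt have "rejects X ((s @ prefix n d) @ [d n]) (suffix (m (Suc n) - m n) (suffix (m n) b))"
        by (meson zero_less_diff)
      moreover have "suffix (m (Suc n) - m n) (suffix (m n) b) = suffix (m (Suc n)) b"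
        using lt by simp
      moreover have "(s @ prefix n d) @ [d n] = s @ prefix (Suc n) d"
        by simp
      ultimately show ?case
        by metis
    qed
    obtain k where k: "\<And>l. k \<le> l \<Longrightarrow> cone (prefix l (s \<frown> d)) (suffix l (s \<frown> d)) \<subseteq> X"
      using open_contains_cone[OF X d(2)] by metis
    \<comment> \<open>Counting \<open>k\<close> from the end of \<open>s\<close> gives the finite
      part the form \<open>s @ prefix k d\<close> to which \<open>rejects\<close> applies.\<close>
    have "prefix (length s + k) (s \<frown> d) = s @ prefix k d" "suffix (length s + k) (s \<frown> d) = suffix k d"
      by (subst prefix_conc_snd suffix_conc_snd; simp)+
    then have "cone (s @ prefix k d) (suffix k d) \<subseteq> X"
      using k[of "length s + k"] by simp
    then show False
      using rejects[of k] m(2)[of k] by (auto simp: rejects_def)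
  qed
  then show ?thesis
    using b(1) by blast
qed

section \<open>Avoiding nowhere dense and meager sets\<close>

lemma dense_open_cone:
  assumes N: "nowhere_dense_in T N" and s: "set s \<subseteq> A" and a: "a \<in> sequences A"
  shows "\<exists>b. le b a \<and> cone s b \<inter> T closure_of N = {}"
proof -
  let ?O = "topspace T - T closure_of N"
  have "openin T ?O"
    by (intro openin_diff) auto
  then obtain b where b: "le b a" "cone s b \<subseteq> ?O \<or> cone s b \<inter> ?O = {}"
    using open_set_cone s a by blast
  have bA: "b \<in> sequences A"
    using le_sequence[OF b(1) a] .
  have "cone s b \<noteq> {}"
    using le_refl[OF bA] by (auto simp: cone_def)
  moreover have "openin T (cone s b)"
    using openin_cone s bA by blast
  \<comment> \<open>A nonempty open cone inside the closure would lie in its empty interior; this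
    excludes the second alternative for \<open>b\<close>.\<close>
  ultimately have "\<not> cone s b \<subseteq> T closure_of N"
    using N interior_of_maximal unfolding nowhere_dense_in_def by blast
  then show ?thesis
    using b openin_subset[OF \<open>openin T (cone s b)\<close>] by blast
qed

text \<open>Fusion spreads the countably many sets over the stages: a finite part \<open>t\<close>
  has to avoid only those with index up to \<open>length t\<close>. For fixed \<open>i\<close>,
  every \<open>s \<frown> d\<close> lies in a cone whose finite part extends \<open>s\<close> by
  \<open>i\<close> entries, and so it avoids \<open>N i\<close>.\<close>

lemma meager_cone:
  assumes M: "meager_in T M" and s: "set s \<subseteq> A" and a: "a \<in> sequences A"
  shows "\<exists>b. le b a \<and> cone s b \<inter> M = {}"
proof -
  obtain N :: "nat \<Rightarrow> 'a word set" where N: "\<And>i. nowhere_dense_in T (N i)" and M_eq: "M = (\<Union>i. N i)"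
    using M unfolding meager_in_def by blast
  let ?P = "\<lambda>t d. set t \<subseteq> A \<longrightarrow> (\<forall>i\<le>length t. cone (s @ t) d \<inter> N i = {})"
  have dense: "\<exists>d. le d c \<and> ?P t d" if t: "set t \<subseteq> A" and c: "c \<in> sequences A" for t c
  proof -
    have "\<exists>d. le d c \<and> (\<forall>i<k. cone (s @ t) d \<inter> N i = {})" for k
    proof (induction k)
      case 0
      show ?case
        using le_refl[OF c] by (metis not_less0)
    next
      case (Suc k)
      then obtain d where d: "le d c" "\<forall>i<k. cone (s @ t) d \<inter> N i = {}"
        by blast
      have dA: "d \<in> sequences A"
        using le_sequence[OF d(1) c] .
      obtain e where e: "le e d" "cone (s @ t) e \<inter> T closure_of N k = {}"
        using dense_open_cone[OF N _ dA, of "s @ t" k] s t by auto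
      have "N k \<subseteq> T closure_of N k"
        using N[of k] closure_of_subset[of "N k" T] by (simp add: nowhere_dense_in_def)
      then have "cone (s @ t) e \<inter> N k = {}"
        using e(2) by blast
      moreover have "cone (s @ t) e \<inter> N i = {}" if "i < k" for i
        using d(2)[rule_format, OF that] cone_mono[OF e(1) dA, of "s @ t"] by blast
      ultimately have "\<forall>i<Suc k. cone (s @ t) e \<inter> N i = {}"
        unfolding less_Suc_eq by metis
      then show ?case
        using le_trans[OF e(1) d(1) c] by blast
    qed
    from this[of "Suc (length t)"] show ?thesis
      by (auto simp: less_Suc_eq_le)
  qed
  have hereditary: "?P t c" if "?P t d" "le c d" "d \<in> sequences A" for t c d
    using that(1) cone_mono[OF that(2,3), of "s @ t"] by (meson disjoint_iff subsetD)
  obtain b where b: "le b a"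
    "\<And>i t. set t \<subseteq> V (prefix i b) \<Longrightarrow> length t \<le> i \<Longrightarrow> ?P t (suffix i b)"
  proof (rule fusion[of ?P])
    show "\<exists>d. le d c \<and> ?P t d" if "set t \<subseteq> A" "c \<in> sequences A" for t c
      using that by (rule dense)
    show "?P t c" if "?P t d" "le c d" "d \<in> sequences A" for t c d
      using that by (rule hereditary)
  qed (use a in blast)+
  have bA: "b \<in> sequences A"
    using le_sequence[OF b(1) a] .
  have "s \<frown> d \<notin> N i" if d: "le d b" for d i
  proof -
    obtain m where m: "strict_mono m" "\<And>n. le (suffix n d) (suffix (m n) b)"
        "\<And>k. d k \<in> V (b [m k \<rightarrow> m (Suc k)])"
      using le_decompose[OF d bA] by metis
    have "d k \<in> V (prefix (m i) b)" if "k < i" for k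
    proof -
      have "m (Suc k) \<le> m i"
        using that m(1) by (simp add: strict_mono_less_eq)
      then show ?thesis
        using m(3)[of k] V_interval_mono[of 0 "m k" "m (Suc k)" "m i" b] by auto
    qed
    then have "set (prefix i d) \<subseteq> V (prefix (m i) b)"
      by auto
    moreover have "V (prefix (m i) b) \<subseteq> A"
      using V_closed sequence_interval[OF bA] by blast
    ultimately have "\<forall>j\<le>i. cone (s @ prefix i d) (suffix (m i) b) \<inter> N j = {}"
      using b(2)[of "prefix i d" "m i"] strict_mono_imp_increasing[OF m(1), of i] by auto
    moreover have "s \<frown> d = (s @ prefix i d) \<frown> suffix i d"
      using prefix_suffix[of d i] by (metis conc_conc)
    then have "s \<frown> d \<in> cone (s @ prefix i d) (suffix (m i) b)"
      using m(2)[of i] unfolding cone_def by blast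
    ultimately show ?thesis
      by blast
  qed
  then have "cone s b \<inter> M = {}"
    by (auto simp: cone_def M_eq)
  then show ?thesis
    using b(1) by blast
qed

text \<open>The meager difference is avoided first; on the remaining cone \<open>X\<close> and
  \<open>U\<close> coincide, and the open set \<open>U\<close> can be decided there.\<close>

theorem ramsey_space_le:
  assumes "A \<noteq> {}"
  shows "ramsey_space (sequences A) le"
  unfolding ramsey_space_def
proof (intro conjI allI impI)
  show "preorder_with_approximations (sequences A) le"
    unfolding preorder_with_approximations_def
    using assms le_refl le_trans by (auto simp: reflp_on_def transp_on_def)
  fix X assume "property_of_Baire T X"
  then obtain U where U: "openin T U" "meager_in T (sym_diff X U)"
    unfolding property_of_Baire_def by blast
  show "ramsey_set (sequences A) le X"
    unfolding ramsey_set_iff_cone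
  proof (intro allI impI)
    fix s a assume s: "set s \<subseteq> A" and a: "a \<in> sequences A"
    obtain b where b: "le b a" "cone s b \<inter> sym_diff X U = {}"
      using meager_cone[OF U(2) s a] by blast
    have bA: "b \<in> sequences A"
      using le_sequence[OF b(1) a] .
    obtain c where c: "le c b" "cone s c \<subseteq> U \<or> cone s c \<inter> U = {}"
      using open_set_cone[OF U(1) s bA] by blast
    have "cone s c \<subseteq> X \<or> cone s c \<inter> X = {}"
      using b(2) c(2) cone_mono[OF c(1) bA, of s] by blast
    then show "\<exists>b. le b a \<and> (cone s b \<subseteq> X \<or> cone s b \<inter> X = {})"
      using le_trans[OF c(1) b(1) a] by blast
  qed
qed

end


section \<open>Orderly terms\<close>

lemma identity_op_operations: "identity_op A \<in> operations A"
  by (auto simp: identity_op_def operations_def tuples_def length_Suc_conv)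

lemma orderly_terms_operations:
  assumes "H \<subseteq> operations A" shows "orderly_terms A H \<subseteq> operations A"
  unfolding orderly_terms_def
  using assms identity_op_operations by (intro Inter_lower) (auto simp: orderly_composition_def)

lemma orderly_terms_base: "H \<subseteq> orderly_terms A H"
  unfolding orderly_terms_def by blast

lemma orderly_terms_identity: "identity_op A \<in> orderly_terms A H"
  unfolding orderly_terms_def by blast

lemma orderly_composition_mono:
  "orderly_composition A C f \<Longrightarrow> C \<subseteq> D \<Longrightarrow> orderly_composition A D f"
  unfolding orderly_composition_def by (meson subset_iff)

lemma orderly_terms_composition:
  assumes "orderly_composition A (orderly_terms A H) f"
  shows "f \<in> orderly_terms A H"
  unfolding orderly_terms_def
proof
  fix C
  assume C: "C \<in> {C. C \<subseteq> operations A \<and> H \<subseteq> C \<and> identity_op A \<in> C \<and>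
                  (\<forall>f. orderly_composition A C f \<longrightarrow> f \<in> C)}"
  then have "orderly_terms A H \<subseteq> C"
    unfolding orderly_terms_def by (rule Inter_lower)
  with assms have "orderly_composition A C f"
    by (rule orderly_composition_mono)
  with C show "f \<in> C"
    by blast
qed

lemma orderly_terms_minimal:
  assumes "C \<subseteq> operations A" "H \<subseteq> C" "identity_op A \<in> C"
    "\<And>f. orderly_composition A C f \<Longrightarrow> f \<in> C"
  shows "orderly_terms A H \<subseteq> C"
  unfolding orderly_terms_def by (rule Inter_lower) (simp add: assms)

lemma app_closed: "f \<in> operations A \<Longrightarrow> xs \<in> tuples A (arity f) \<Longrightarrow> app f xs \<in> A"
  by (auto simp: operations_def)

lemma arity_pos: "f \<in> operations A \<Longrightarrow> 0 < arity f"
  by (auto simp: operations_def)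

lemma app_identity: "x \<in> A \<Longrightarrow> app (identity_op A) [x] = x"
  by (simp add: identity_op_def tuples_def)

text \<open>An orderly composition is specified only on concatenations of blocks. Cutting by the
  arities recovers the blocks, so a composite can be defined explicitly.\<close>

fun chop :: "nat list \<Rightarrow> 'a list \<Rightarrow> 'a list list" where
  "chop [] xs = []"
| "chop (n # ns) xs = take n xs # chop ns (drop n xs)"

lemma chop_concat:
  "list_all2 (\<lambda>h zs. length zs = arity h) hs zss \<Longrightarrow> chop (map arity hs) (concat zss) = zss"
  by (induction rule: list_all2_induct) auto

lemma concat_chop: "length xs = sum_list ns \<Longrightarrow> concat (chop ns xs) = xs"
  by (induction ns arbitrary: xs) auto

lemma chop_tuples:
  "length xs = sum_list (map arity hs) \<Longrightarrow> set xs \<subseteq> A \<Longrightarrow>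
     list_all2 (\<lambda>h ys. ys \<in> tuples A (arity h)) hs (chop (map arity hs) xs)"
proof (induction hs arbitrary: xs)
  case (Cons h hs)
  then have "list_all2 (\<lambda>h ys. ys \<in> tuples A (arity h)) hs (chop (map arity hs) (drop (arity h) xs))"
    by (metis (no_types, lifting) add_diff_cancel_left' dual_order.trans length_drop list.simps(9)
        set_drop_subset sum_list.Cons)
  with Cons.prems show ?case
    by (auto simp: tuples_def dest: in_set_takeD)
qed simp

lemma map2_app_tuples:
  "list_all2 (\<lambda>h ys. ys \<in> tuples A (arity h)) hs yss \<Longrightarrow> set hs \<subseteq> operations A \<Longrightarrow>
     map2 app hs yss \<in> tuples A (length hs)"
  by (induction rule: list_all2_induct) (auto simp: tuples_def app_closed)

lemma orderly_composition_exists: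
  assumes H: "H \<subseteq> operations A" and g: "g \<in> orderly_terms A H"
    and hs: "set hs \<subseteq> orderly_terms A H" "length hs = arity g"
    and zss: "list_all2 (\<lambda>h zs. length zs = arity h) hs zss" "set (concat zss) \<subseteq> A"
  obtains f where "f \<in> orderly_terms A H" "arity f = length (concat zss)"
    "app f (concat zss) = app g (map2 app hs zss)"
proof -
  let ?n = "sum_list (map arity hs)"
  \<comment> \<open>\<open>restrict\<close> makes the composite extensional, as membership in
    \<open>operations A\<close> requires.\<close>
  define f where
    "f = (?n, restrict (\<lambda>xs. app g (map2 app hs (chop (map arity hs) xs))) (tuples A ?n))"
  have T: "g \<in> operations A" "set hs \<subseteq> operations A"
    using g hs(1) orderly_terms_operations[OF H] by blast+
  \<comment> \<open>As \<open>g\<close> has positive arity, \<open>hs\<close> is nonempty, and its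
    members have positive arity too; no nullary composite arises.\<close>
  have "0 < ?n"
  proof -
    obtain h hs' where "hs = h # hs'"
      using hs(2) arity_pos[OF T(1)] by (cases hs) auto
    then show ?thesis
      using T(2) arity_pos[of h A] by simp
  qed
  moreover have "app g (map2 app hs (chop (map arity hs) xs)) \<in> A" if "xs \<in> tuples A ?n" for xs
    using that map2_app_tuples[OF chop_tuples T(2)] app_closed[OF T(1)] hs(2)
    by (simp add: tuples_def)
  ultimately have op: "f \<in> operations A"
    by (auto simp: f_def operations_def)
  have "app f (concat xss) = app g (map2 app hs xss)"
    if xss: "list_all2 (\<lambda>h xs. xs \<in> tuples A (arity h)) hs xss" for xss
  proof -
    have "list_all2 (\<lambda>h xs. length xs = arity h) hs xss"
      using xss by (rule list_all2_mono) (simp add: tuples_def)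
    moreover from this have "length (concat xss) = ?n"
      by (induction rule: list_all2_induct) auto
    moreover have "set (concat xss) \<subseteq> A"
      using xss by (induction rule: list_all2_induct) (auto simp: tuples_def)
    ultimately show ?thesis
      by (simp add: f_def tuples_def chop_concat)
  qed
  moreover have zss': "list_all2 (\<lambda>h xs. xs \<in> tuples A (arity h)) hs zss"
    using zss by (induction rule: list_all2_induct) (auto simp: tuples_def)
  moreover have "orderly_composition A (orderly_terms A H) f"
    unfolding orderly_composition_def
    using op g hs calculation(1) by (intro conjI bexI[of _ g] exI[of _ hs]) (auto simp: f_def)
  moreover have "length (concat zss) = ?n"
    using zss(1) by (induction rule: list_all2_induct) auto
  ultimately have "f \<in> orderly_terms A H" "arity f = length (concat zss)"
    "app f (concat zss) = app g (map2 app hs zss)"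
    using orderly_terms_composition[of A H f] by (simp_all add: f_def del: length_concat)
  then show thesis
    by (rule that)
qed

section \<open>Values of orderly terms at subsequences of a list\<close>

definition term_vals :: "'a set \<Rightarrow> 'a operation set \<Rightarrow> 'a list \<Rightarrow> 'a set" where
  "term_vals A H xs = {app f ys |f ys. f \<in> orderly_terms A H \<and> subseq ys xs \<and> length ys = arity f}"

lemma term_valsI:
  "f \<in> orderly_terms A H \<Longrightarrow> subseq ys xs \<Longrightarrow> length ys = arity f \<Longrightarrow> app f ys \<in> term_vals A H xs"
  unfolding term_vals_def by blast

lemma term_valsE:
  assumes "x \<in> term_vals A H xs"
  obtains f ys where "x = app f ys" "f \<in> orderly_terms A H" "subseq ys xs" "length ys = arity f"
  using assms unfolding term_vals_def by blast

lemma term_vals_terms: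
  assumes "list_all2 (\<lambda>x ys. x \<in> term_vals A H ys) xs yss"
  obtains hs zss where "set hs \<subseteq> orderly_terms A H" "length hs = length xs"
    "list_all2 (\<lambda>h zs. length zs = arity h) hs zss"
    "xs = map2 app hs zss" "subseq (concat zss) (concat yss)"
proof -
  from assms have "\<exists>hs zss. set hs \<subseteq> orderly_terms A H \<and> length hs = length xs \<and>
    list_all2 (\<lambda>h zs. length zs = arity h) hs zss \<and>
    xs = map2 app hs zss \<and> subseq (concat zss) (concat yss)"
  proof (induction rule: list_all2_induct)
    case Nil
    show ?case
      by (intro exI[of _ "[]"]) simp
  next
    case (Cons x xs ys yss)
    then obtain hs zss where IH: "set hs \<subseteq> orderly_terms A H" "length hs = length xs"
      "list_all2 (\<lambda>h zs. length zs = arity h) hs zss"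
      "xs = map2 app hs zss" "subseq (concat zss) (concat yss)"
      by blast
    obtain h zs where "x = app h zs" "h \<in> orderly_terms A H" "subseq zs ys" "length zs = arity h"
      using Cons.hyps(1) by (rule term_valsE)
    with IH show ?case
      by (intro exI[of _ "h # hs"] exI[of _ "zs # zss"]) (auto intro: list_emb_append_mono)
  qed
  with that show thesis
    by blast
qed

text \<open>Dropped entries take their blocks with them. This serves \<open>V_concat\<close>, where
  the outer term reads only a subsequence of \<open>xs\<close>.\<close>

lemma subseq_list_all2:
  assumes "subseq xs' xs" "list_all2 P xs yss"
  shows "\<exists>yss'. list_all2 P xs' yss' \<and> subseq (concat yss') (concat yss)"
  using assms
proof (induction arbitrary: yss rule: list_emb.induct)
  case (list_emb_Nil ys)
  show ?case
    by (intro exI[of _ "[]"]) simp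
next
  case (list_emb_Cons xs ys y)
  then show ?case
    by (auto simp: list_all2_Cons1) (meson subseq_drop_many)
next
  case (list_emb_Cons2 x y xs ys)
  then obtain z zs where z: "yss = z # zs" "P y z" "list_all2 P ys zs"
    by (auto simp: list_all2_Cons1)
  with list_emb_Cons2 obtain yss' where "list_all2 P xs yss'" "subseq (concat yss') (concat zs)"
    by blast
  with z list_emb_Cons2.hyps show ?case
    by (intro exI[of _ "z # yss'"]) (auto intro: list_emb_append_mono)
qed

lemma subseq_set: "subseq xs ys \<Longrightarrow> set xs \<subseteq> set ys"
  by (induction rule: list_emb.induct) auto

text \<open>\<open>V_single\<close> comes from the identity operation and \<open>V_concat\<close>
  from closure under orderly composition.\<close>

lemma term_values_term_vals:
  assumes H: "H \<subseteq> operations A"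
  shows "term_values A (term_vals A H)"
proof
  fix xs :: "'a list" assume xs: "set xs \<subseteq> A"
  show "term_vals A H xs \<subseteq> A"
  proof
    fix x assume "x \<in> term_vals A H xs"
    then obtain f ys where f: "x = app f ys" "f \<in> orderly_terms A H" "subseq ys xs" "length ys = arity f"
      by (rule term_valsE)
    have "f \<in> operations A" "ys \<in> tuples A (arity f)"
      using f orderly_terms_operations[OF H] subseq_set[OF f(3)] xs by (auto simp: tuples_def)
    then show "x \<in> A"
      unfolding f(1) by (rule app_closed)
  qed
next
  fix x assume "x \<in> A"
  then have "app (identity_op A) [x] = x"
    by (rule app_identity)
  moreover have "length [x] = arity (identity_op A)"
    by (simp add: identity_op_def)
  ultimately show "x \<in> term_vals A H [x]"
    using term_valsI[OF orderly_terms_identity subseq_order.refl] by metis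
next
  fix xs ys :: "'a list" assume "subseq ys xs"
  then show "term_vals A H ys \<subseteq> term_vals A H xs"
    by (auto elim!: term_valsE intro: term_valsI subseq_order.trans)
next
  fix xs yss assume vals: "list_all2 (\<lambda>x ys. x \<in> term_vals A H ys) xs yss"
    and yss: "set (concat yss) \<subseteq> A"
  show "term_vals A H xs \<subseteq> term_vals A H (concat yss)"
  proof
    fix x assume "x \<in> term_vals A H xs"
    then obtain g xs' where g: "x = app g xs'" "g \<in> orderly_terms A H" "subseq xs' xs"
      "length xs' = arity g"
      by (rule term_valsE)
    obtain yss' where yss': "list_all2 (\<lambda>x ys. x \<in> term_vals A H ys) xs' yss'"
      "subseq (concat yss') (concat yss)"
      using subseq_list_all2[OF g(3) vals] by blast
    obtain hs zss where zss: "set hs \<subseteq> orderly_terms A H" "length hs = length xs'"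
      "list_all2 (\<lambda>h zs. length zs = arity h) hs zss"
      "xs' = map2 app hs zss" "subseq (concat zss) (concat yss')"
      using term_vals_terms[OF yss'(1)] .
    have sub: "subseq (concat zss) (concat yss)"
      using zss(5) yss'(2) by (rule subseq_order.trans)
    then have "set (concat zss) \<subseteq> A"
      using subseq_set yss by blast
    with zss(2) g(4) obtain f where f: "f \<in> orderly_terms A H" "arity f = length (concat zss)"
      "app f (concat zss) = app g (map2 app hs zss)"
      using orderly_composition_exists[OF H g(2) zss(1) _ zss(3)] by metis
    then show "x \<in> term_vals A H (concat yss)"
      unfolding g(1) zss(4) using term_valsI[OF f(1) sub] by simp
  qed
qed


section \<open>Reductions as block decompositions\<close>

lemma subseq_mapE:
  assumes "subseq ys (map a xs)"
  obtains ns where "ys = map a ns" "subseq ns xs"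
  using assms by (metis nths_map subseq_conv_nths)

lemma subseq_upt_iff: "subseq ns [i..<j] \<longleftrightarrow> sorted_wrt (<) ns \<and> set ns \<subseteq> {i..<j}"
proof
  assume sub: "subseq ns [i..<j]"
  then have "sorted_wrt (<) ns"
    by (metis sorted_list_of_set_nonempty sorted_upt sorted_wrt_upt subseq_conv_nths strict_sorted_iff sorted_nths distinct_nthsI distinct_upt)
  then show "sorted_wrt (<) ns \<and> set ns \<subseteq> {i..<j}"
    using subseq_set[OF sub] by simp
next
  assume "sorted_wrt (<) ns \<and> set ns \<subseteq> {i..<j}"
  then show "subseq ns [i..<j]"
    by (intro sorted_subset_imp_subseq) (auto simp: strict_sorted_iff)
qed

lemma FR_eq: "FR A H b = (\<Union>n. term_vals A H (prefix n b))"
proof (intro equalityI subsetI)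
  fix x assume "x \<in> FR A H b"
  then obtain f ns where f: "x = app f (map b ns)" "f \<in> orderly_terms A H"
    "sorted_wrt (<) ns" "length ns = arity f"
    by (auto simp: FR_def)
  obtain n where "set ns \<subseteq> {0..<n}"
    using finite_nat_iff_bounded[of "set ns"] by (auto simp: lessThan_atLeast0)
  then have "subseq ns [0..<n]"
    using f(3) by (simp add: subseq_upt_iff)
  then have "subseq (map b ns) (prefix n b)"
    unfolding subsequence_def by (rule subseq_map)
  then have "x \<in> term_vals A H (prefix n b)"
    unfolding f(1) using f(2,4) by (intro term_valsI) simp_all
  then show "x \<in> (\<Union>n. term_vals A H (prefix n b))"
    by blast
next
  fix x assume "x \<in> (\<Union>n. term_vals A H (prefix n b))"
  then obtain n where "x \<in> term_vals A H (map b [0..<n])"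
    by (auto simp: subsequence_def)
  then obtain f ys where f: "x = app f ys" "f \<in> orderly_terms A H" "subseq ys (map b [0..<n])"
    "length ys = arity f"
    by (rule term_valsE)
  obtain ns where ns: "ys = map b ns" "subseq ns [0..<n]"
    using f(3) by (rule subseq_mapE)
  then have "sorted_wrt (<) ns" "length ns = arity f"
    using f(4) by (simp_all add: subseq_upt_iff)
  then show "x \<in> FR A H b"
    unfolding FR_def using f(1,2) ns(1) by blast
qed

section \<open>Infinite concatenation of nonempty blocks\<close>

lemma length_concat_ge:
  assumes "\<And>k. xss k \<noteq> []"
  shows "n \<le> length (concat (map xss [0..<n]))"
proof (induction n)
  case (Suc n)
  have "Suc 0 \<le> length (xss n)"
    using assms[of n] by (simp add: Suc_le_eq)
  with Suc have "n + Suc 0 \<le> length (concat (map xss [0..<n])) + length (xss n)"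
    by (rule add_mono)
  then show ?case
    by simp
qed simp

text \<open>Both sides can be read off from the concatenation of the first \<open>Suc i + n\<close>
  lists, which prolongs either finite concatenation.\<close>

lemma nth_concat_iconcat:
  assumes nonempty: "\<And>k. xss k \<noteq> []" and i: "i < length (concat (map xss [0..<n]))"
  shows "concat (map xss [0..<n]) ! i = iconcat xss i"
proof -
  have prefix: "concat (map xss [0..<p + q]) ! i = concat (map xss [0..<p]) ! i"
    if "i < length (concat (map xss [0..<p]))" for p q
    using that by (simp add: upt_add_eq_append[of 0 p q] nth_append)
  have "i < length (concat (map xss [0..<Suc i]))"
    using length_concat_ge[of xss "Suc i", OF nonempty] by linarith
  then have "concat (map xss [0..<Suc i + n]) ! i = iconcat xss i"
    using prefix[of "Suc i" n] unfolding iconcat_def by blast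
  moreover have "concat (map xss [0..<Suc i + n]) ! i = concat (map xss [0..<n]) ! i"
    using prefix[OF i, of "Suc i"] by (simp only: add.commute)
  ultimately show ?thesis
    by simp
qed

lemma concat_eq_prefix_iconcat:
  assumes "\<And>k. xss k \<noteq> []"
  shows "concat (map xss [0..<n]) = prefix (length (concat (map xss [0..<n]))) (iconcat xss)"
  by (rule nth_equalityI) (simp_all add: nth_concat_iconcat[of xss, OF assms] del: length_concat)

text \<open>The images under \<open>\<phi>\<close> of the block starts are cutting points, strictly
  increasing because arities are positive. Conversely, indices chosen inside successive intervals
  concatenate to an increasing sequence, which serves as \<open>\<phi>\<close>.\<close>

lemma reduces_iff:
  assumes H: "H \<subseteq> operations A"
  shows "reduces A H b a \<longleftrightarrow>
    (\<exists>m. strict_mono m \<and> (\<forall>k. b k \<in> term_vals A H (a [m k \<rightarrow> m (Suc k)])))"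
proof
  have arity: "arity f \<noteq> 0" if "f \<in> orderly_terms A H" for f
    using that orderly_terms_operations[OF H] arity_pos by blast
  {
    assume "reduces A H b a"
    then obtain xss fs \<phi> where fs: "\<And>k. fs k \<in> orderly_terms A H"
        "\<And>k. length (xss k) = arity (fs k)" "\<And>k. b k = app (fs k) (xss k)"
      and \<phi>: "strict_mono \<phi>" "iconcat xss = a \<circ> \<phi>"
      unfolding reduces_def by blast
    have nonempty: "xss k \<noteq> []" for k
      using fs(1,2)[of k] arity[of "fs k"] by auto
    define l where "l k = length (concat (map xss [0..<k]))" for k
    have l_Suc: "l (Suc k) = l k + length (xss k)" for k
      by (simp add: l_def)
    have block: "xss k = iconcat xss [l k \<rightarrow> l (Suc k)]" for k
    proof -
      have "xss k = drop (l k) (concat (map xss [0..<Suc k]))"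
        by (simp add: l_def)
      also have "\<dots> = drop (l k) (prefix (l (Suc k)) (iconcat xss))"
        unfolding l_def by (subst concat_eq_prefix_iconcat[OF nonempty]) simp
      finally show ?thesis
        by simp
    qed
    have "b k \<in> term_vals A H (a [\<phi> (l k) \<rightarrow> \<phi> (l (Suc k))])" for k
    proof -
      have "xss k = map a (map \<phi> [l k..<l (Suc k)])"
        using block[of k] by (simp add: \<phi>(2) subsequence_def)
      moreover have "sorted_wrt (<) (map \<phi> [l k..<l (Suc k)])"
        using strict_monoD[OF \<phi>(1)] by (auto simp: sorted_wrt_map intro: sorted_wrt_mono_rel[OF _ sorted_wrt_upt])
      then have "subseq (map \<phi> [l k..<l (Suc k)]) [\<phi> (l k)..<\<phi> (l (Suc k))]"
        unfolding subseq_upt_iff using \<phi>(1) by (auto simp: strict_mono_less strict_mono_less_eq)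
      then have "subseq (map a (map \<phi> [l k..<l (Suc k)])) (a [\<phi> (l k) \<rightarrow> \<phi> (l (Suc k))])"
        unfolding subsequence_def by (rule subseq_map)
      ultimately show ?thesis
        unfolding fs(3)[of k] using fs(1,2)[of k] by (intro term_valsI) simp_all
    qed
    moreover have "strict_mono (\<lambda>k. \<phi> (l k))"
      unfolding strict_mono_Suc_iff using \<phi>(1) nonempty by (simp add: l_Suc strict_mono_less)
    ultimately show "\<exists>m. strict_mono m \<and> (\<forall>k. b k \<in> term_vals A H (a [m k \<rightarrow> m (Suc k)]))"
      by (intro exI[of _ "\<lambda>k. \<phi> (l k)"] conjI allI)
  }
  {
    assume "\<exists>m. strict_mono m \<and> (\<forall>k. b k \<in> term_vals A H (a [m k \<rightarrow> m (Suc k)]))"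
    then obtain m where m: "strict_mono m" "\<And>k. b k \<in> term_vals A H (a [m k \<rightarrow> m (Suc k)])"
      by blast
    have "\<exists>f ns. f \<in> orderly_terms A H \<and> subseq ns [m k..<m (Suc k)] \<and> length ns = arity f \<and>
        b k = app f (map a ns)" for k
    proof -
      obtain f ys where f: "b k = app f ys" "f \<in> orderly_terms A H"
        "subseq ys (map a [m k..<m (Suc k)])" "length ys = arity f"
        using m(2)[of k] unfolding subsequence_def by (rule term_valsE)
      obtain ns where "ys = map a ns" "subseq ns [m k..<m (Suc k)]"
        using f(3) by (rule subseq_mapE)
      then show ?thesis
        using f by (intro exI[of _ f] exI[of _ ns]) simp
    qed
    then obtain fs nss where fs: "\<And>k. fs k \<in> orderly_terms A H"
        "\<And>k. subseq (nss k) [m k..<m (Suc k)]" "\<And>k. length (nss k) = arity (fs k)"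
        "\<And>k. b k = app (fs k) (map a (nss k))"
      by metis
    have nonempty: "nss k \<noteq> []" for k
      using fs(1,3)[of k] arity[of "fs k"] by auto
    \<comment> \<open>The bound by \<open>m n\<close> is carried along because the next indices all
      lie in \<open>[m n..<m (Suc n)]\<close>.\<close>
    have sorted: "sorted_wrt (<) (concat (map nss [0..<n])) \<and> (\<forall>i\<in>set (concat (map nss [0..<n])). i < m n)" for n
    proof (induction n)
      case (Suc n)
      have "sorted_wrt (<) (nss n)" "set (nss n) \<subseteq> {m n..<m (Suc n)}"
        using fs(2)[of n] by (auto simp: subseq_upt_iff)
      moreover have "m n < m (Suc n)"
        using m(1) by (simp add: strict_monoD)
      ultimately show ?case
        using Suc by (fastforce simp: sorted_wrt_append)
    qed simp
    have "strict_mono (iconcat nss)"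
      unfolding strict_mono_Suc_iff
    proof
      fix i
      let ?xs = "concat (map nss [0..<Suc (Suc i)])"
      have len: "Suc i < length ?xs"
        using length_concat_ge[of nss "Suc (Suc i)", OF nonempty] by linarith
      then have "?xs ! i < ?xs ! Suc i"
        using sorted by (intro sorted_wrt_nth_less[of "(<)"]) (blast, auto)
      then show "iconcat nss i < iconcat nss (Suc i)"
        using nth_concat_iconcat[of nss, OF nonempty] len by (metis Suc_lessD)
    qed
    moreover have "iconcat (\<lambda>k. map a (nss k)) = a \<circ> iconcat nss"
    proof
      fix i
      have "i < length (concat (map nss [0..<Suc i]))"
        using length_concat_ge[of nss "Suc i", OF nonempty] by linarith
      moreover have "concat (map (\<lambda>k. map a (nss k)) [0..<Suc i]) = map a (concat (map nss [0..<Suc i]))"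
        by (simp only: map_concat map_map o_def)
      ultimately show "iconcat (\<lambda>k. map a (nss k)) i = (a \<circ> iconcat nss) i"
        unfolding iconcat_def o_apply by (simp only: nth_map)
    qed
    ultimately show "reduces A H b a"
      unfolding reduces_def using fs
      by (intro exI[of _ "\<lambda>k. map a (nss k)"] exI[of _ fs] conjI exI[of _ "iconcat nss"]) auto
  }
qed


section \<open>Common fixed points of the unary operations\<close>

text \<open>A well-order splits the points by whether \<open>h\<close> decreases them, so no homogeneous set is
  decreasing.  On an increasing set \<open>h\<close> has no cycles, and the parity of the signed distance to a
  representative of the \<open>h\<close>-orbit alternates along orbits.\<close>

lemma fixed_point_free_not_homogeneous:
  fixes h :: "'a \<Rightarrow> 'a"
  shows "\<exists>X Y. \<forall>S. S \<noteq> {} \<longrightarrow> (\<forall>x\<in>S. h x \<in> S \<and> h x \<noteq> x) \<longrightarrow>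
    S \<subseteq> X \<or> S \<inter> X = {} \<longrightarrow> S \<subseteq> Y \<or> S \<inter> Y = {} \<longrightarrow> False"
proof -
  obtain r :: "'a rel" where r: "Well_order r" "Field r = UNIV"
    using well_ordering by metis
  then have wf: "wf (r - Id)" and total: "total r" and trans: "trans r" and antisym: "antisym r"
    unfolding well_order_on_def linear_order_on_def partial_order_on_def preorder_on_def by simp_all
  have trans': "trans (r - Id)"
    using trans antisym by (rule trans_diff_Id)
  \<comment> \<open>Two points belong to one orbit when some iterates of theirs agree;
    \<open>x\<close> itself qualifies, so the choice is legitimate.\<close>
  define rep where "rep x = (SOME y. \<exists>m n. (h ^^ m) x = (h ^^ n) y)" for x
  have rep: "\<exists>m n. (h ^^ m) x = (h ^^ n) (rep x)" for x
    unfolding rep_def by (rule someI[of _ x]) blast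
  have "(\<exists>m n. (h ^^ m) (h x) = (h ^^ n) y) \<longleftrightarrow> (\<exists>m n. (h ^^ m) x = (h ^^ n) y)" for x y
  proof
    assume "\<exists>m n. (h ^^ m) (h x) = (h ^^ n) y"
    then obtain m n where "(h ^^ Suc m) x = (h ^^ n) y"
      by (auto simp: funpow_swap1)
    then show "\<exists>m n. (h ^^ m) x = (h ^^ n) y"
      by blast
  next
    assume "\<exists>m n. (h ^^ m) x = (h ^^ n) y"
    then obtain m n where "(h ^^ m) x = (h ^^ n) y"
      by blast
    then have "(h ^^ m) (h x) = (h ^^ Suc n) y"
      by (simp flip: funpow_swap1)
    then show "\<exists>m n. (h ^^ m) (h x) = (h ^^ n) y"
      by blast
  qed
  then have rep_h: "rep (h x) = rep x" for x
    by (simp add: rep_def)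
  define X where "X = {x. (h x, x) \<in> r - Id}"
  \<comment> \<open>The signed distance is \<open>m - n\<close>; the sum \<open>m + n\<close> has
    the same parity and stays within the naturals.\<close>
  define Y where "Y = {x. \<exists>m n. (h ^^ m) x = (h ^^ n) (rep x) \<and> even (m + n)}"
  have contradiction: False
    if "S \<noteq> {}" and h: "\<And>x. x \<in> S \<Longrightarrow> h x \<in> S \<and> h x \<noteq> x"
      and X: "S \<subseteq> X \<or> S \<inter> X = {}" and Y: "S \<subseteq> Y \<or> S \<inter> Y = {}" for S
  proof -
    obtain x where x: "x \<in> S"
      using \<open>S \<noteq> {}\<close> by blast
    have not_decr: "\<not> S \<subseteq> X"
    proof
      assume "S \<subseteq> X"
      obtain z where "z \<in> S" "\<And>y. (y, z) \<in> r - Id \<Longrightarrow> y \<notin> S"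
        using wfE_min[OF wf x] by metis
      then show False
        using \<open>S \<subseteq> X\<close> h unfolding X_def by blast
    qed
    then have incr: "(y, h y) \<in> r - Id" if "y \<in> S" for y
    proof -
      have "(h y, y) \<notin> r"
        using not_decr X h[OF that] that unfolding X_def by blast
      then show ?thesis
        using total h[OF that] unfolding total_on_def by (metis DiffI UNIV_I pair_in_Id_conv)
    qed
    have pow: "(h ^^ n) y \<in> S" if "y \<in> S" for y n
      by (induction n) (simp_all add: that h)
    have pow_incr: "(y, (h ^^ Suc n) y) \<in> r - Id" if "y \<in> S" for y n
    proof (induction n)
      case 0
      then show ?case
        using incr[OF that] by simp
    next
      case (Suc n)
      then show ?case
        using transD[OF trans' Suc incr[OF pow[OF that]]] by simp
    qed
    have acyclic: "(h ^^ n) y \<noteq> y" if "y \<in> S" "0 < n" for y n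
      using pow_incr[OF that(1), of "n - 1"] that(2) by auto
    \<comment> \<open>\<open>z\<close> will be an orbit representative, which may lie outside
      \<open>S\<close>; hence membership is asked of the common iterate.\<close>
    have inj: "p = q" if "(h ^^ p) z = (h ^^ q) z" "(h ^^ p) z \<in> S" for p q z
    proof (rule ccontr)
      assume "p \<noteq> q"
      moreover have False if "p < q" "(h ^^ p) z = (h ^^ q) z" "(h ^^ p) z \<in> S" for p q
      proof -
        have "(h ^^ (q - p)) ((h ^^ p) z) = (h ^^ q) z"
          using that(1) by (metis funpow_add le_add_diff_inverse2 less_or_eq_imp_le o_apply)
        then show False
          using acyclic[OF that(3), of "q - p"] that(1,2) by simp
      qed
      ultimately show False
        using that by (metis linorder_neqE_nat)
    qed
    have balance: "m + q = p + n"
      if "(h ^^ m) y = (h ^^ n) z" "(h ^^ p) y = (h ^^ q) z" "y \<in> S" for m n p q y z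
    proof -
      have eq: "(h ^^ (p + n)) z = (h ^^ (p + m)) y"
        using that(1) by (simp add: funpow_add)
      also have "\<dots> = (h ^^ (m + q)) z"
        using that(2) by (simp add: add.commute[of p] funpow_add)
      finally have "p + n = m + q"
        by (rule inj) (simp add: eq pow[OF that(3)])
      then show ?thesis ..
    qed
    show False
      using Y
    proof
      assume "S \<subseteq> Y"
      then have "x \<in> Y" "h x \<in> Y"
        using x h[OF x] by blast+
      obtain m n where mn: "(h ^^ m) x = (h ^^ n) (rep x)" "even (m + n)"
        using \<open>x \<in> Y\<close> unfolding Y_def by blast
      obtain p q where "(h ^^ p) (h x) = (h ^^ q) (rep (h x))" "even (p + q)"
        using \<open>h x \<in> Y\<close> unfolding Y_def by blast
      then have pq: "(h ^^ Suc p) x = (h ^^ q) (rep x)" "even (p + q)"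
        by (simp_all add: rep_h funpow_swap1)
      have "m + q = Suc p + n"
        using balance[OF mn(1) pq(1) x] .
      then show False
        using mn(2) pq(2) by presburger
    next
      assume Y: "S \<inter> Y = {}"
      obtain m n where mn: "(h ^^ m) x = (h ^^ n) (rep x)"
        using rep by blast
      \<comment> \<open>The exponents \<open>m\<close>, \<open>n\<close> for \<open>x\<close> give
        \<open>m\<close>, \<open>Suc n\<close> for \<open>h x\<close>, and both sums would have to
        be odd.\<close>
      then have "(h ^^ m) (h x) = (h ^^ Suc n) (rep (h x))"
        by (simp add: rep_h flip: funpow_swap1)
      then have "odd (m + Suc n)" "odd (m + n)"
        using Y x h[OF x] mn unfolding Y_def by blast+
      then show False
        by simp
    qed
  qed
  show ?thesis
    by (intro exI[of _ X] exI[of _ Y] allI impI) (rule contradiction; assumption?; erule bspec; assumption)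
qed

lemma ramsey_algebra_fixed_points:
  assumes H: "H \<subseteq> operations A" and G: "G \<subseteq> H" "\<And>g. g \<in> G \<Longrightarrow> arity g = 1"
    and ramsey: "ramsey_algebra A H" and a: "a \<in> sequences A"
  obtains b where "term_values.le (term_vals A H) b a"
    "FR A H b \<subseteq> {x \<in> A. \<forall>g\<in>G. app g [x] = x}"
proof -
  interpret term_values A "term_vals A H"
    using H by (rule term_values_term_vals)
  have le_iff: "reduces A H b c \<longleftrightarrow> le b c" for b c
    unfolding le_def using H by (rule reduces_iff)
  have FR_A: "FR A H b \<subseteq> A" if "b \<in> sequences A" for b
    unfolding FR_eq using V_closed sequence_interval[OF that] by blast
  have homogeneous: "\<exists>b. le b c \<and> b \<in> sequences A \<and> (FR A H b \<subseteq> X \<or> FR A H b \<inter> X = {})"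
    if c: "c \<in> sequences A" for c X
  proof -
    obtain b where "b \<in> sequences A" "le b c" "FR A H b \<subseteq> X \<inter> A \<or> FR A H b \<inter> (X \<inter> A) = {}"
      using ramsey c unfolding ramsey_algebra_def le_iff by (meson inf_le2)
    then show ?thesis
      using FR_A by blast
  qed
  have FR_le: "FR A H b \<subseteq> FR A H c" if bc: "le b c" and c: "c \<in> sequences A" for b c
  proof -
    obtain m where m: "\<And>i j. term_vals A H (b [i \<rightarrow> j]) \<subseteq> term_vals A H (c [m i \<rightarrow> m j])"
      using le_decompose[OF bc c] by metis
    have "term_vals A H (prefix n b) \<subseteq> term_vals A H (prefix (m n) c)" for n
      using m[of 0 n] V_interval_mono[of 0 "m 0" "m n" "m n" c] by auto
    then show ?thesis
      unfolding FR_eq by blast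
  qed
  have FR_G: "app g [x] \<in> FR A H b" if b: "b \<in> sequences A" and x: "x \<in> FR A H b" and g: "g \<in> G" for b x g
  proof -
    obtain n where n: "x \<in> term_vals A H (prefix n b)"
      using x unfolding FR_eq by blast
    have "app g [x] \<in> term_vals A H [x]"
      using g G orderly_terms_base[of H A] by (intro term_valsI) auto
    also have "\<dots> \<subseteq> term_vals A H (concat [prefix n b])"
      using n sequence_interval[OF b, of 0 n] by (intro V_concat) auto
    finally show ?thesis
      unfolding FR_eq by auto
  qed
  define E where "E = {x \<in> A. \<forall>g\<in>G. app g [x] = x}"
  obtain b where b: "le b a" "b \<in> sequences A" "FR A H b \<subseteq> E \<or> FR A H b \<inter> E = {}"
    using homogeneous[OF a] by blast
  have "FR A H b \<subseteq> E"
  proof (rule ccontr)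
    assume "\<not> FR A H b \<subseteq> E"
    then have disj: "FR A H b \<inter> E = {}"
      using b(3) by blast
    \<comment> \<open>A single map stands in for the possibly infinite \<open>G\<close>. It need not
      be a term: \<open>FR\<close> is closed under each \<open>g\<close>, hence under this pointwise
      choice.\<close>
    define h where "h x = app (SOME g. g \<in> G \<and> app g [x] \<noteq> x) [x]" for x
    have h: "h x \<in> FR A H c \<and> h x \<noteq> x" if c: "le c b" "c \<in> sequences A" and x: "x \<in> FR A H c" for c x
    proof -
      have "x \<in> A - E"
        using x FR_A[OF c(2)] FR_le[OF c(1) b(2)] disj by blast
      then have "\<exists>g. g \<in> G \<and> app g [x] \<noteq> x"
        unfolding E_def by blast
      then have "(SOME g. g \<in> G \<and> app g [x] \<noteq> x) \<in> G \<and> h x \<noteq> x"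
        unfolding h_def by (rule someI_ex)
      then show ?thesis
        using FR_G[OF c(2) x] unfolding h_def by blast
    qed
    obtain X Y where XY: "\<forall>S. S \<noteq> {} \<longrightarrow> (\<forall>x\<in>S. h x \<in> S \<and> h x \<noteq> x) \<longrightarrow>
        S \<subseteq> X \<or> S \<inter> X = {} \<longrightarrow> S \<subseteq> Y \<or> S \<inter> Y = {} \<longrightarrow> False"
      using fixed_point_free_not_homogeneous[of h] by (elim exE)
    \<comment> \<open>Homogeneity for \<open>X\<close> survives the second refinement, because
      \<open>FR\<close> shrinks along reductions.\<close>
    obtain c where c: "le c b" "c \<in> sequences A" "FR A H c \<subseteq> X \<or> FR A H c \<inter> X = {}"
      using homogeneous[OF b(2)] by blast
    obtain d where d: "le d c" "d \<in> sequences A" "FR A H d \<subseteq> Y \<or> FR A H d \<inter> Y = {}"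
      using homogeneous[OF c(2)] by blast
    have "d 0 \<in> term_vals A H (prefix (Suc 0) d)"
      using V_single[OF sequence_entries[OF d(2)]] by simp
    then have "FR A H d \<noteq> {}"
      unfolding FR_eq by blast
    moreover have "FR A H d \<subseteq> X \<or> FR A H d \<inter> X = {}"
      using c(3) FR_le[OF d(1) c(2)] by blast
    moreover have "le d b"
      using le_trans[OF d(1) c(1) b(2)] .
    moreover have "\<forall>x\<in>FR A H d. h x \<in> FR A H d \<and> h x \<noteq> x"
      using h[OF \<open>le d b\<close> d(2)] by blast
    ultimately show False
      using XY d(3) by blast
  qed
  with b(1) that show thesis
    unfolding E_def by blast
qed


section \<open>Finitely many values\<close>

text \<open>Where the unary operations act trivially, an orderly term agrees with one over \<open>F\<close>; as no
  operation in \<open>F\<close> is unary, only finitely many of those fit a given list of arguments.\<close>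

inductive exact_value :: "'a operation set \<Rightarrow> 'a list \<Rightarrow> 'a \<Rightarrow> bool" for F where
  single: "exact_value F [x] x"
| app: "f \<in> F \<Longrightarrow> arity f = length yss \<Longrightarrow> list_all2 (\<lambda>v ys. exact_value F ys v) vs yss \<Longrightarrow>
    exact_value F (concat yss) (app f vs)"

lemma exact_value_nonempty:
  assumes "exact_value F xs x" "\<And>f. f \<in> F \<Longrightarrow> 2 \<le> arity f"
  shows "xs \<noteq> []"
  using assms(1)
proof induction
  case (app f yss vs)
  then obtain v vs' ys yss' where "vs = v # vs'" "yss = ys # yss'"
    using assms(2)[OF app(1)] by (cases yss) (auto simp: list_all2_Cons2)
  with app show ?case
    by simp
qed simp

text \<open>With at least two nonempty blocks, each block is a strictly shorter subsequence of
  \<open>xs\<close>. By induction the arguments of the outermost operation range over a finite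
  set.\<close>

lemma finite_exact_values:
  assumes F: "finite F" "\<And>f. f \<in> F \<Longrightarrow> 2 \<le> arity f"
  shows "finite {x. exact_value F xs x}"
proof (induction "length xs" arbitrary: xs rule: less_induct)
  case less
  let ?shorter = "{ys. subseq ys xs \<and> length ys < length xs}"
  let ?B = "\<Union>ys\<in>?shorter. {x. exact_value F ys x}"
  have "finite ?shorter"
    by (rule finite_subset[of _ "set (subseqs xs)"]) auto
  then have B: "finite ?B"
    using less by blast
  have "{x. exact_value F xs x} \<subseteq> set xs \<union> (\<Union>f\<in>F. app f ` {vs. set vs \<subseteq> ?B \<and> length vs = arity f})"
  proof
    fix x assume "x \<in> {x. exact_value F xs x}"
    then have "exact_value F xs x"
      by simp
    then show "x \<in> set xs \<union> (\<Union>f\<in>F. app f ` {vs. set vs \<subseteq> ?B \<and> length vs = arity f})"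
    proof cases
      case (app f yss vs)
      have nonempty: "zs \<noteq> []" if zs: "zs \<in> set yss" for zs
      proof -
        obtain i where "i < length yss" "zs = yss ! i"
          using zs by (auto simp: in_set_conv_nth)
        then have "exact_value F zs (vs ! i)"
          using app(5) by (auto simp: list_all2_conv_all_nth)
        then show ?thesis
          by (rule exact_value_nonempty) (rule F(2))
      qed
      have "v \<in> ?B" if v: "v \<in> set vs" for v
      proof -
        obtain i where "i < length vs" "v = vs ! i"
          using v by (auto simp: in_set_conv_nth)
        then have "yss ! i \<in> set yss" "exact_value F (yss ! i) v"
          using app(5) by (auto simp: list_all2_conv_all_nth)
        then obtain ys where ys: "ys \<in> set yss" "exact_value F ys v"
          by blast
        then obtain us ws where us: "yss = us @ ys # ws"
          by (meson split_list)
        then have "us @ ws \<noteq> []"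
          using F(2)[OF app(3)] app(4) by auto
        then obtain zs where zs: "zs \<in> set (us @ ws)"
          by (meson ex_in_conv set_empty)
        then have "zs \<noteq> []"
          by (intro nonempty) (auto simp: us)
        with zs have "concat (us @ ws) \<noteq> []"
          by (meson concat_eq_Nil_conv)
        then have "length ys < length xs"
          unfolding app(1) us by auto
        moreover have "subseq ys xs"
          unfolding app(1) us by (simp add: subseq_drop_many subseq_rev_drop_many)
        ultimately show ?thesis
          using ys(2) by blast
      qed
      moreover have "length vs = arity f"
        using app(4,5) by (simp add: list_all2_lengthD)
      ultimately show ?thesis
        unfolding app(2) using app(3) by blast
    qed simp
  qed
  moreover have "finite {vs. set vs \<subseteq> ?B \<and> length vs = arity f}" for f
    using B by (rule finite_lists_length_eq)
  ultimately show ?case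
    using F(1) by (elim finite_subset) blast
qed

section \<open>Composition of exact values and passage to arbitrary orderly terms\<close>

lemma list_all2_concat_left:
  "list_all2 P (concat xss) ys \<Longrightarrow> \<exists>yss. ys = concat yss \<and> list_all2 (list_all2 P) xss yss"
proof (induction xss arbitrary: ys)
  case (Cons xs xss)
  then obtain us vs where "ys = us @ vs" "list_all2 P xs us" "list_all2 P (concat xss) vs"
    by (auto simp: list_all2_append1)
  moreover from this(3) Cons.IH obtain yss where "vs = concat yss" "list_all2 (list_all2 P) xss yss"
    by blast
  ultimately show ?case
    by (intro exI[of _ "us # yss"]) simp
qed simp

text \<open>\<open>exact_value\<close> describes trees of operations in \<open>F\<close> whose
  leaves, in order, form the list; further trees are grafted onto the leaves.
  \<open>list_all2_concat_left\<close> distributes the blocks among the subtrees.\<close>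

lemma exact_value_compose:
  assumes "exact_value F vs x" "list_all2 (\<lambda>v ys. exact_value F ys v) vs yss"
  shows "exact_value F (concat yss) x"
  using assms
proof (induction arbitrary: yss)
  case (single x)
  then show ?case
    by (auto simp: list_all2_Cons1)
next
  case (app f vss us)
  obtain zsss where z: "yss = concat zsss" "list_all2 (list_all2 (\<lambda>v ys. exact_value F ys v)) vss zsss"
    using list_all2_concat_left[OF app.prems] by blast
  have "list_all2 (\<lambda>u zss. exact_value F (concat zss) u) us zsss"
    by (rule list_all2_trans[OF _ app.IH z(2)]) blast
  then have "exact_value F (concat (map concat zsss)) (app f us)"
    using app.hyps list_all2_lengthD[OF z(2)]
    by (intro exact_value.app) (simp_all add: list_all2_map2)
  moreover have "concat (map concat zsss) = concat (concat zsss)"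
    by (induction zsss) simp_all
  ultimately show ?case
    by (simp add: z(1))
qed

text \<open>Induction over orderly terms, where operations in \<open>G\<close> collapse to
  \<open>single\<close>. In a composite, the values on each block and on the list of intermediate
  results are among those on \<open>ys\<close>, so the fixed-point hypothesis reaches both
  levels.\<close>

lemma orderly_term_exact_value:
  assumes FG: "F \<union> G \<subseteq> operations A" and G: "\<And>g. g \<in> G \<Longrightarrow> arity g = 1"
    and t: "t \<in> orderly_terms A (F \<union> G)" and ys: "ys \<in> tuples A (arity t)"
    and fixed: "\<And>x g. x \<in> term_vals A (F \<union> G) ys \<Longrightarrow> g \<in> G \<Longrightarrow> app g [x] = x"
  shows "exact_value F ys (app t ys)"
proof -
  interpret term_values A "term_vals A (F \<union> G)"
    using FG by (rule term_values_term_vals)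
  let ?T = "orderly_terms A (F \<union> G)" and ?V = "term_vals A (F \<union> G)"
  let ?fixed = "\<lambda>ys. \<forall>x\<in>?V ys. \<forall>g\<in>G. app g [x] = x"
  \<comment> \<open>\<open>C\<close> stays inside \<open>?T\<close> so that the results of the inner
    terms count as values of orderly terms.\<close>
  define C where "C = {t \<in> ?T. \<forall>ys\<in>tuples A (arity t). ?fixed ys \<longrightarrow> exact_value F ys (app t ys)}"
  have "?T \<subseteq> C"
  proof (rule orderly_terms_minimal)
    show "C \<subseteq> operations A"
      using orderly_terms_operations[OF FG] unfolding C_def by blast
    show "F \<union> G \<subseteq> C"
    proof
      fix f assume f: "f \<in> F \<union> G"
      have "exact_value F ys (app f ys)" if ys: "ys \<in> tuples A (arity f)" "?fixed ys" for ys
      proof (cases "f \<in> F")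
        case True
        have "exact_value F (concat (map (\<lambda>y. [y]) ys)) (app f ys)"
          using True ys(1)
          by (intro exact_value.app) (auto simp: tuples_def list_all2_map2 intro: list_all2_refl single)
        then show ?thesis
          by simp
      next
        case False
        then have "f \<in> G" "arity f = 1"
          using f G by auto
        then obtain y where y: "ys = [y]" "y \<in> A"
          using ys(1) by (auto simp: tuples_def length_Suc_conv)
        then have "app f [y] = y"
          using V_single ys(2) \<open>f \<in> G\<close> by blast
        then show ?thesis
          by (simp add: y(1) single)
      qed
      then show "f \<in> C"
        using f orderly_terms_base unfolding C_def by blast
    qed
    show "identity_op A \<in> C"
    proof -
      have "exact_value F ys (app (identity_op A) ys)" if ys: "ys \<in> tuples A (arity (identity_op A))" for ys
      proof -
        obtain y where y: "ys = [y]" "y \<in> A"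
          using ys by (auto simp: identity_op_def tuples_def length_Suc_conv)
        show ?thesis
          unfolding y(1) app_identity[OF y(2)] by (rule single)
      qed
      then show ?thesis
        using orderly_terms_identity unfolding C_def by blast
    qed
    fix f assume f: "orderly_composition A C f"
    then have fT: "f \<in> ?T"
      by (intro orderly_terms_composition orderly_composition_mono[OF f]) (auto simp: C_def)
    obtain g hs where g: "g \<in> C" and hs: "set hs \<subseteq> C" "arity g = length hs"
      and arity_f: "arity f = sum_list (map arity hs)"
      and app_f: "\<And>xss. list_all2 (\<lambda>h xs. xs \<in> tuples A (arity h)) hs xss \<Longrightarrow>
           app f (concat xss) = app g (map2 app hs xss)"
      using f unfolding orderly_composition_def by blast
    have hsA: "set hs \<subseteq> operations A"
      using hs(1) orderly_terms_operations[OF FG] unfolding C_def by blast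
    have "exact_value F ys (app f ys)" if ys: "ys \<in> tuples A (arity f)" "?fixed ys" for ys
    proof -
      define xss where "xss = chop (map arity hs) ys"
      have conc: "concat xss = ys" and xss: "list_all2 (\<lambda>h xs. xs \<in> tuples A (arity h)) hs xss"
        using ys(1) unfolding xss_def
        by (simp add: tuples_def arity_f concat_chop) (rule chop_tuples; use ys(1) in \<open>simp add: tuples_def arity_f\<close>)
      let ?vs = "map2 app hs xss"
      have len: "length hs = length xss"
        using xss by (rule list_all2_lengthD)
      have entry: "exact_value F (xss ! i) (app (hs ! i) (xss ! i))"
        "app (hs ! i) (xss ! i) \<in> ?V (xss ! i)" if i: "i < length hs" for i
      proof -
        have xs: "xss ! i \<in> tuples A (arity (hs ! i))"
          using xss i by (simp add: list_all2_conv_all_nth)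
        have h: "hs ! i \<in> C"
          using hs(1) i by auto
        have "xss ! i \<in> set xss"
          using i len by simp
        then obtain us ws where "xss = us @ xss ! i # ws"
          by (meson split_list)
        then have "ys = concat us @ xss ! i @ concat ws"
          using conc by (metis concat.simps(2) concat_append)
        then have "subseq (xss ! i) ys"
          by (metis subseq_drop_many subseq_order.refl subseq_rev_drop_many)
        then have "?fixed (xss ! i)"
          using ys(2) V_subseq by blast
        then show "exact_value F (xss ! i) (app (hs ! i) (xss ! i))"
          using h xs unfolding C_def by blast
        show "app (hs ! i) (xss ! i) \<in> ?V (xss ! i)"
          using h xs by (intro term_valsI) (auto simp: C_def tuples_def)
      qed
      have "list_all2 (\<lambda>v xs. v \<in> ?V xs) ?vs xss"
        using entry(2) len by (simp add: list_all2_conv_all_nth)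
      then have "?V ?vs \<subseteq> ?V (concat xss)"
        using ys(1) conc by (intro V_concat) (auto simp: tuples_def)
      then have "?fixed ?vs"
        using ys(2) conc by blast
      moreover have "?vs \<in> tuples A (arity g)"
        using map2_app_tuples[OF xss hsA] hs(2) by simp
      ultimately have "exact_value F ?vs (app g ?vs)"
        using g unfolding C_def by blast
      moreover have "list_all2 (\<lambda>v xs. exact_value F xs v) ?vs xss"
        using entry(1) len by (simp add: list_all2_conv_all_nth)
      ultimately have "exact_value F (concat xss) (app g ?vs)"
        by (rule exact_value_compose)
      then show ?thesis
        using app_f[OF xss] conc by simp
    qed
    then show "f \<in> C"
      using fT unfolding C_def by blast
  qed
  then show ?thesis
    using t ys fixed unfolding C_def by blast
qed

lemma finite_term_vals:
  assumes FG: "F \<union> G \<subseteq> operations A" and F: "finite F" "\<And>f. f \<in> F \<Longrightarrow> arity f \<noteq> 1"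
    and G: "\<And>g. g \<in> G \<Longrightarrow> arity g = 1" and xs: "set xs \<subseteq> A"
    and fixed: "\<And>x g. x \<in> term_vals A (F \<union> G) xs \<Longrightarrow> g \<in> G \<Longrightarrow> app g [x] = x"
  shows "finite (term_vals A (F \<union> G) xs)"
proof -
  interpret term_values A "term_vals A (F \<union> G)"
    using FG by (rule term_values_term_vals)
  have "term_vals A (F \<union> G) xs \<subseteq> (\<Union>ys\<in>set (subseqs xs). {x. exact_value F ys x})"
  proof
    fix x assume "x \<in> term_vals A (F \<union> G) xs"
    then obtain f ys where f: "x = app f ys" "f \<in> orderly_terms A (F \<union> G)" "subseq ys xs"
      "length ys = arity f"
      by (rule term_valsE)
    have "ys \<in> tuples A (arity f)"
      using f(4) subseq_set[OF f(3)] xs by (auto simp: tuples_def)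
    then have "exact_value F ys x"
      unfolding f(1) using FG G f(2) fixed V_subseq[OF f(3)]
      by (intro orderly_term_exact_value[of F G A]) auto
    with f(3) show "x \<in> (\<Union>ys\<in>set (subseqs xs). {x. exact_value F ys x})"
      by auto
  qed
  moreover have "2 \<le> arity f" if "f \<in> F" for f
  proof -
    have "0 < arity f"
      using that FG arity_pos by blast
    with F(2)[OF that] show ?thesis
      by linarith
  qed
  then have "finite (\<Union>ys\<in>set (subseqs xs). {x. exact_value F ys x})"
    using finite_exact_values[OF F(1)] by blast
  ultimately show ?thesis
    by (rule finite_subset)
qed


section \<open>The equivalence\<close>

context term_values
begin

lemma ramsey_space_imp_pigeonhole:
  assumes space: "ramsey_space (sequences A) le" and a: "a \<in> sequences A"
  shows "\<exists>b. le b a \<and> ((\<forall>n. V (prefix n b) \<subseteq> Y) \<or> (\<forall>n. V (prefix n b) \<inter> Y = {}))"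
proof -
  let ?U = "{b \<in> sequences A. b 0 \<in> Y}"
  have "approx_nbhd (sequences A) le 1 b \<subseteq> ?U" if "b \<in> ?U" for b
    using that by (auto simp: approx_nbhd_def)
  then have "openin T ?U"
    unfolding openin_T by blast
  moreover have "nowhere_dense_in T {}"
    by (simp add: nowhere_dense_in_def)
  then have "meager_in T (sym_diff ?U ?U)"
    unfolding meager_in_def by (intro exI[of _ "\<lambda>_. {}"]) simp
  ultimately have "property_of_Baire T ?U"
    unfolding property_of_Baire_def topspace_T by blast
  moreover have "?U \<subseteq> sequences A"
    by blast
  ultimately have "ramsey_set (sequences A) le ?U"
    using space unfolding ramsey_space_def by blast
  then have "\<exists>b. le b a \<and> (cone [] b \<subseteq> ?U \<or> cone [] b \<inter> ?U = {})"
    unfolding ramsey_set_iff_cone using a by (elim allE[of _ "[]"]) simp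
  then obtain b where b: "le b a" "cone [] b \<subseteq> ?U \<or> cone [] b \<inter> ?U = {}"
    by blast
  have bA: "b \<in> sequences A"
    using le_sequence[OF b(1) a] .
  \<comment> \<open>Every value on \<open>b\<close> is the head of some reduction of
    \<open>b\<close>, so deciding first entries decides the value sets of all prefixes.\<close>
  have head: "\<exists>d\<in>cone [] b. d \<in> sequences A \<and> d 0 = x" if x: "x \<in> V (prefix n b)" for x n
  proof -
    \<comment> \<open>Resuming at \<open>Suc n\<close> keeps the first block nonempty even for
      \<open>n = 0\<close>, as strictly increasing cutting points demand.\<close>
    let ?d = "[x] \<frown> suffix (Suc n) b"
    have "le ?d b"
      unfolding le_def
    proof (intro exI[of _ "\<lambda>k. if k = 0 then 0 else n + k"] conjI allI)
      show "strict_mono (\<lambda>k. if k = 0 then 0 else n + k)"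
        by (simp add: strict_mono_def)
      show "?d k \<in> V (b [if k = 0 then 0 else n + k \<rightarrow> if Suc k = 0 then 0 else n + Suc k])" for k
      proof (cases k)
        case 0
        then show ?thesis
          using x V_interval_mono[of 0 0 n "Suc n" b] by auto
      next
        case (Suc l)
        then show ?thesis
          using V_single[OF sequence_entries[OF bA]] by simp
      qed
    qed
    then show ?thesis
      using le_sequence[OF _ bA] by (intro bexI[of _ ?d]) (auto simp: cone_def)
  qed
  show ?thesis
  proof (intro exI[of _ b] conjI)
    show "le b a"
      by (rule b(1))
    show "(\<forall>n. V (prefix n b) \<subseteq> Y) \<or> (\<forall>n. V (prefix n b) \<inter> Y = {})"
      using b(2)
    proof
      assume "cone [] b \<subseteq> ?U"
      then have "\<forall>n. V (prefix n b) \<subseteq> Y"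
        using head by blast
      then show ?thesis ..
    next
      assume "cone [] b \<inter> ?U = {}"
      then have "\<forall>n. V (prefix n b) \<inter> Y = {}"
        using head by blast
      then show ?thesis ..
    qed
  qed
qed

end

theorem theorem6p11:
  fixes A :: "'a set" and F G :: "'a operation set"
  assumes "A \<noteq> {}"
    and "finite F" and "F \<subseteq> operations A" and "\<And>f. f \<in> F \<Longrightarrow> arity f \<noteq> 1"
    and "G \<subseteq> operations A" and "\<And>g. g \<in> G \<Longrightarrow> arity g = 1"
  shows "ramsey_space (sequences A) (reduces A (F \<union> G)) \<longleftrightarrow> ramsey_algebra A (F \<union> G)"
proof -
  let ?H = "F \<union> G"
  have H: "?H \<subseteq> operations A"
    using assms(3,5) by blast
  interpret term_values A "term_vals A ?H"
    using H by (rule term_values_term_vals)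
  have reduces_eq: "reduces A ?H = le"
    unfolding fun_eq_iff le_def using reduces_iff[OF H] by blast
  show ?thesis
    unfolding reduces_eq
  proof
    assume space: "ramsey_space (sequences A) le"
    show "ramsey_algebra A ?H"
      unfolding ramsey_algebra_def reduces_eq
    proof (intro ballI allI impI)
      fix a X assume a: "a \<in> sequences A" and "X \<subseteq> A"
      obtain b where b: "le b a"
        "(\<forall>n. term_vals A ?H (prefix n b) \<subseteq> X) \<or> (\<forall>n. term_vals A ?H (prefix n b) \<inter> X = {})"
        using ramsey_space_imp_pigeonhole[OF space a] by blast
      then have "FR A ?H b \<subseteq> X \<or> FR A ?H b \<inter> X = {}"
        unfolding FR_eq by blast
      then show "\<exists>b\<in>sequences A. le b a \<and> (FR A ?H b \<subseteq> X \<or> FR A ?H b \<inter> X = {})"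
        using b(1) le_sequence[OF b(1) a] by blast
    qed
  next
    assume algebra: "ramsey_algebra A ?H"
    interpret ramsey_term_values A "term_vals A ?H"
    proof
      fix a assume a: "a \<in> sequences A"
      fix Y
      \<comment> \<open>\<open>ramsey_algebra\<close> colours by subsets of \<open>A\<close> only,
        hence \<open>Y \<inter> A\<close>; since \<open>FR\<close> stays inside \<open>A\<close>,
        homogeneity for \<open>Y\<close> follows.\<close>
      obtain b where b: "b \<in> sequences A" "le b a" "FR A ?H b \<subseteq> Y \<inter> A \<or> FR A ?H b \<inter> (Y \<inter> A) = {}"
        using algebra a unfolding ramsey_algebra_def reduces_eq by (meson inf_le2)
      moreover have "FR A ?H b \<subseteq> A"
        unfolding FR_eq using V_closed sequence_interval[OF b(1)] by blast
      ultimately have "FR A ?H b \<subseteq> Y \<or> FR A ?H b \<inter> Y = {}"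
        by blast
      then have "(\<forall>n. term_vals A ?H (prefix n b) \<subseteq> Y) \<or> (\<forall>n. term_vals A ?H (prefix n b) \<inter> Y = {})"
        unfolding FR_eq by blast
      with b(2) show "\<exists>b. le b a \<and> ((\<forall>n. term_vals A ?H (prefix n b) \<subseteq> Y) \<or>
          (\<forall>n. term_vals A ?H (prefix n b) \<inter> Y = {}))"
        by blast
    next
      fix a assume a: "a \<in> sequences A"
      obtain b where b: "le b a" "FR A ?H b \<subseteq> {x \<in> A. \<forall>g\<in>G. app g [x] = x}"
        using ramsey_algebra_fixed_points[OF H _ assms(6) algebra a] by blast
      have "finite (term_vals A ?H (prefix n b))" for n
      proof (rule finite_term_vals[OF H assms(2,4,6)])
        show "set (prefix n b) \<subseteq> A"
          using le_sequence[OF b(1) a] by (rule sequence_interval)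
        show "app g [x] = x" if "x \<in> term_vals A ?H (prefix n b)" "g \<in> G" for x g
          using that b(2) unfolding FR_eq by blast
      qed
      with b(1) show "\<exists>b. le b a \<and> (\<forall>n. finite (term_vals A ?H (prefix n b)))"
        by blast
    qed
    show "ramsey_space (sequences A) le"
      using assms(1) by (rule ramsey_space_le)
  qed
qed

end
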